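(* Let $\varepsilon\ge0$ and let $\{z^t\}_{t\ge0}$ be the sequence generated by Stochastic Amplitude Flow, $z^{t+1}=z^t-\mu_t\,g_\varepsilon(z^t)$, with an arbitrary starting point $z^0\in\mathbb C^d$. Suppose the step sizes $\mu_t$ are positive and satisfy $$\sum_{t=0}^\infty\mu_t=\infty,\qquad\sum_{t=0}^\infty\mu_t^2<\infty,\qquad\beta\|A\|^2\mu_t\le1\ \text{ for all }t\ge0 .$$ Then $\mathcal L_\varepsilon(z^t)$ converges almost surely as $t\to\infty$, the random variable $C^2:=\sum_{t=0}^\infty\mu_t\|\nabla_z\mathcal L_\varepsilon(z^t)\|_2^2$ is finite almost surely, and, with $C\ge 0$, for all $T\ge1$ $$\min_{t=0,\dots,T-1}\|\nabla_z\mathcal L_\varepsilon(z^t)\|_2\le C\left[\sum_{t=0}^{T-1}\mu_t\right]^{-1/2}\quad\text{almost surely.}$$ If additionally $\{\mu_t\}_{t\ge 0}$ is decreasing and $\sum_{t=1}^\infty\frac{\mu_t}{\sum_{s=0}^{t-1}\mu_s}=\infty$, then $$\min_{t=0,\dots,T-1}\|\nabla_z\mathcal L_\varepsilon(z^t)\|_2=o\left(\left[\sum_{t=0}^{T-1}\mu_t\right]^{-1/2}\right)\quad\text{as }T\to\infty,\ \text{almost surely.}$$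
   Context: Let $A\in\mathbb C^{m\times d}$ and $y\in[0,\infty)^m$ (phase retrieval measurements $y=|Ax|^2+n$ of an unknown $x\in\mathbb C^d$ with perturbation $n\in\mathbb R^m$). Functions such as $|\cdot|$, square, square root and addition of a constant act entrywise on vectors; $\circ$ and $/$ between vectors are entrywise product and division; $\operatorname{sgn}(a)=a/|a|$ for $a\ne0$ and $\operatorname{sgn}(0)=0$, applied entrywise. $\|\cdot\|$ is the spectral norm of a matrix. For $\varepsilon\ge0$ the loss is $\mathcal L_\varepsilon(z)=\|\sqrt{|Az|^2+\varepsilon}-\sqrt{y+\varepsilon}\|_2^2$, $z\in\mathbb C^d$. Its (generalized) Wirtinger gradient is $\nabla_z\mathcal L_\varepsilon(z)=A^*(Az-\sqrt{y+\varepsilon}\circ Az/\sqrt{|Az|^2+\varepsilon})$ for $\varepsilon>0$ and $\nabla_z\mathcal L_0(z)=A^*(Az-\sqrt y\circ\operatorname{sgn}(Az))$ for $\varepsilon=0$. Partition the rows of $A$ into $R$ blocks $A_1,\dots,A_R$ ($1\le R\le m$), with $y^1,\dots,y^R$ the corresponding blocks of $y$. Let $\mathcal L_{\varepsilon,r}(z)=\|\sqrt{|A_rz|^2+\varepsilon}-\sqrt{y^r+\varepsilon}\|_2^2$, so $\mathcal L_\varepsilon=\sum_{r=1}^R\mathcal L_{\varepsilon,r}$; $\nabla_z\mathcal L_{\varepsilon,r}$ is defined by the same formulas with $(A_r,y^r)$ in place of $(A,y)$. Let $p$ be a probability distribution on $\{1,\dots,R\}$ with $0<p_r<1$ for all $r$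 and $\sum_r p_r=1$, and let $K\in\mathbb N$, $K\ge1$. The stochastic gradient is $g_\varepsilon(z)=\frac1K\sum_{k=1}^K\frac{1}{p_{r_k}}\nabla_z\mathcal L_{\varepsilon,r_k}(z)$, where $r_1,\dots,r_K$ are drawn independently with replacement from $p$; in Stochastic Amplitude Flow fresh indices, independent of all previous ones, are drawn at every iteration $t$. The constant $\beta$ is $\beta=1-\frac1K$. For sequences, $a_T=o(b_T)$ as $T\to\infty$ means $a_T/b_T\to0$. *)

theory Defs
  imports "HOL-Probability.Probability" "HOL-Library.Landau_Symbols"
begin

definition cadjoint :: "complex^'d^'m \<Rightarrow> complex^'m^'d" where
  "cadjoint A = (\<chi> k j. cnj (A $ j $ k))"

text \<open>On \<open>complex^'n\<close> the library norm is the Euclidean one, and the operator norm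
  of a complex-linear map does not depend on whether the scalars are real or complex.\<close>

definition spectral_norm :: "complex^'d^'m \<Rightarrow> real" where
  "spectral_norm A = onorm (\<lambda>v. A *v v)"

definition amp_loss :: "real \<Rightarrow> complex^'d^'m \<Rightarrow> real^'m \<Rightarrow> complex^'d \<Rightarrow> real" where
  "amp_loss \<epsilon> A y z =
     (norm (\<chi> j. sqrt ((cmod ((A *v z) $ j))\<^sup>2 + \<epsilon>) - sqrt (y $ j + \<epsilon>)))\<^sup>2"

text \<open>The generalized Wirtinger gradient.  The second branch is meant for \<open>\<epsilon> = 0\<close>;
  negative \<open>\<epsilon>\<close> is never used.\<close>

definition amp_grad :: "real \<Rightarrow> complex^'d^'m \<Rightarrow> real^'m \<Rightarrow> complex^'d \<Rightarrow> complex^'d" where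
  "amp_grad \<epsilon> A y z =
     (if \<epsilon> > 0
      then cadjoint A *v
        (A *v z - (\<chi> j. of_real (sqrt (y $ j + \<epsilon>)) * (A *v z) $ j
                          / of_real (sqrt ((cmod ((A *v z) $ j))\<^sup>2 + \<epsilon>))))
      else cadjoint A *v
        (A *v z - (\<chi> j. of_real (sqrt (y $ j)) * sgn ((A *v z) $ j))))"

text \<open>The block of rows with index in \<open>S\<close>.  Since the number of rows of a matrix is a type,
  a block is padded with zero rows (and zero measurements).  The padding contributes nothing
  to the loss or to the gradient: see \<open>amp_loss_row_block\<close> and \<open>amp_grad_row_block\<close>.\<close>

definition row_block :: "'m set \<Rightarrow> ('a::zero)^'m \<Rightarrow> 'a^'m" where
  "row_block S v = (\<chi> j. if j \<in> S then v $ j else 0)"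

definition block_loss ::
    "real \<Rightarrow> complex^'d^'m \<Rightarrow> real^'m \<Rightarrow> 'm set \<Rightarrow> complex^'d \<Rightarrow> real" where
  "block_loss \<epsilon> A y S = amp_loss \<epsilon> (row_block S A) (row_block S y)"

definition block_grad ::
    "real \<Rightarrow> complex^'d^'m \<Rightarrow> real^'m \<Rightarrow> 'm set \<Rightarrow> complex^'d \<Rightarrow> complex^'d" where
  "block_grad \<epsilon> A y S = amp_grad \<epsilon> (row_block S A) (row_block S y)"

definition is_row_partition :: "nat \<Rightarrow> (nat \<Rightarrow> 'm set) \<Rightarrow> bool" where
  "is_row_partition R B \<longleftrightarrow>
     disjoint_family_on B {1..R} \<and> (\<Union>r\<in>{1..R}. B r) = UNIV \<and> (\<forall>r\<in>{1..R}. B r \<noteq> {})"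

text \<open>The stochastic gradient for drawn block indices \<open>i 1, \<dots>, i K\<close>.\<close>

definition stoch_grad ::
    "real \<Rightarrow> complex^'d^'m \<Rightarrow> real^'m \<Rightarrow> (nat \<Rightarrow> 'm set) \<Rightarrow> (nat \<Rightarrow> real) \<Rightarrow> nat
      \<Rightarrow> (nat \<Rightarrow> nat) \<Rightarrow> complex^'d \<Rightarrow> complex^'d" where
  "stoch_grad \<epsilon> A y B p K i z =
     (1 / real K) *\<^sub>R (\<Sum>k\<in>{1..K}. (1 / p (i k)) *\<^sub>R block_grad \<epsilon> A y (B (i k)) z)"

text \<open>The iterates of Stochastic Amplitude Flow along a realization \<open>i\<close> of the indices;
  \<open>i t k\<close> is the \<open>k\<close>-th index drawn at iteration \<open>t\<close>.\<close>

primrec stoch_amp_flow ::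
    "real \<Rightarrow> complex^'d^'m \<Rightarrow> real^'m \<Rightarrow> (nat \<Rightarrow> 'm set) \<Rightarrow> (nat \<Rightarrow> real) \<Rightarrow> nat
      \<Rightarrow> (nat \<Rightarrow> real) \<Rightarrow> complex^'d \<Rightarrow> (nat \<Rightarrow> nat \<Rightarrow> nat) \<Rightarrow> nat \<Rightarrow> complex^'d" where
  "stoch_amp_flow \<epsilon> A y B p K \<mu> z0 i 0 = z0"
| "stoch_amp_flow \<epsilon> A y B p K \<mu> z0 i (Suc t) =
     stoch_amp_flow \<epsilon> A y B p K \<mu> z0 i t
     - \<mu> t *\<^sub>R stoch_grad \<epsilon> A y B p K (i t) (stoch_amp_flow \<epsilon> A y B p K \<mu> z0 i t)"

lemma row_block_mult: "(row_block S A *v z) $ j = (if j \<in> S then (A *v z) $ j else 0)"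
  by (simp add: row_block_def matrix_vector_mult_def)

lemma cadjoint_mult: "(cadjoint A *v u) $ k = (\<Sum>j\<in>UNIV. cnj (A $ j $ k) * u $ j)"
  by (simp add: cadjoint_def matrix_vector_mult_def)

lemma amp_loss_sum:
  "amp_loss \<epsilon> A y z =
     (\<Sum>j\<in>UNIV. (sqrt ((cmod ((A *v z) $ j))\<^sup>2 + \<epsilon>) - sqrt (y $ j + \<epsilon>))\<^sup>2)"
  by (simp add: amp_loss_def norm_vec_def L2_set_def sum_nonneg)

lemma amp_loss_row_block:
  "block_loss \<epsilon> A y S z =
     (\<Sum>j\<in>S. (sqrt ((cmod ((A *v z) $ j))\<^sup>2 + \<epsilon>) - sqrt (y $ j + \<epsilon>))\<^sup>2)"
proof -
  have "block_loss \<epsilon> A y S z =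
     (\<Sum>j\<in>UNIV. if j \<in> S
        then (sqrt ((cmod ((A *v z) $ j))\<^sup>2 + \<epsilon>) - sqrt (y $ j + \<epsilon>))\<^sup>2 else 0)"
    unfolding block_loss_def amp_loss_sum
    by (intro sum.cong refl) (simp add: row_block_mult, simp add: row_block_def)
  then show ?thesis
    by (simp add: sum.If_cases)
qed

lemma amp_grad_row_block:
  "block_grad \<epsilon> A y S z $ k =
     (\<Sum>j\<in>S. cnj (A $ j $ k) *
        ((A *v z) $ j
         - (if \<epsilon> > 0
            then of_real (sqrt (y $ j + \<epsilon>)) * (A *v z) $ j
                   / of_real (sqrt ((cmod ((A *v z) $ j))\<^sup>2 + \<epsilon>))
            else of_real (sqrt (y $ j)) * sgn ((A *v z) $ j))))"
    (is "_ = (\<Sum>j\<in>S. ?f j)")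
proof -
  have "block_grad \<epsilon> A y S z $ k = (\<Sum>j\<in>UNIV. if j \<in> S then ?f j else 0)"
    unfolding block_grad_def amp_grad_def
    by (cases "\<epsilon> > 0"; simp add: cadjoint_mult row_block_mult; intro sum.cong refl;
        simp add: row_block_def)
  then show ?thesis
    by (simp add: sum.If_cases)
qed

lemma amp_loss_blocks:
  assumes "is_row_partition R B"
  shows "amp_loss \<epsilon> A y z = (\<Sum>r\<in>{1..R}. block_loss \<epsilon> A y (B r) z)"
proof -
  have "(\<Sum>j\<in>(\<Union>r\<in>{1..R}. B r). f j) = (\<Sum>r\<in>{1..R}. \<Sum>j\<in>B r. f j)" for f :: "_ \<Rightarrow> real"
    using assms by (intro sum.UNION_disjoint)
      (auto simp: is_row_partition_def disjoint_family_on_def)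
  then show ?thesis
    using assms by (simp add: amp_loss_sum amp_loss_row_block is_row_partition_def)
qed

end

theory Submission
  imports Defs
begin

text \<open>A descent inequality that holds along every path turns the loss into an almost supermartingale,
  and such processes converge.

  The scalar loss \<open>(sqrt ((cmod u)\<^sup>2 + \<epsilon>) - sqrt (\<eta> + \<epsilon>))\<^sup>2\<close> is a quadratic minus a convex function, so it
  lies below the quadratic model built from its generalized gradient
  (\<open>amp_loss_descent\<close>).  The gradients of all blocks are bounded by a constant times the square root
  of the loss (\<open>norm_block_grad_le\<close>).  For a step along the stochastic gradient \<open>g\<close> this gives, with
  the loss \<open>L\<close>, its gradient \<open>G\<close> and a constant \<open>c\<close>, the pathwise inequality
  \<open>L (Suc t) \<le> (1 + c * (\<mu> t)\<^sup>2) * L t - 2 * \<mu> t * (norm (G t))\<^sup>2 + D t\<close> in which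
  \<open>D t = 2 * \<mu> t * inner (G t) (G t - g t)\<close> is at most a multiple of \<open>\<mu> t * L t\<close> in absolute value.
  Because \<open>g\<close> is unbiased given the past, \<open>D\<close> is a martingale difference
  (\<open>martingale_difference_noise\<close>).

  A nonnegative process with such an inequality and \<open>\<Sum>t. (\<mu> t)\<^sup>2 < \<infinity>\<close> converges almost surely, and
  the subtracted terms are summable (\<open>AE_almost_supermartingale_converges\<close>, a theorem of
  Robbins--Siegmund type).  After a deterministic rescaling that removes the factors
  \<open>1 + c * (\<mu> t)\<^sup>2\<close>, the second moments of the process are bounded, so those of \<open>D\<close> are summable.  By
  Kolmogorov's maximal inequality the series of \<open>D\<close> then converges almost surely
  (\<open>AE_summable_martingale_difference\<close>), and on every such path the process is a decreasing bounded
  sequence plus a convergent one.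

  This yields the convergence of the loss and the finiteness of \<open>\<Sum>t. \<mu> t * (norm (G t))\<^sup>2\<close>.  The two
  rates are statements about real sequences: the square of the running minimum times
  \<open>\<Sum>t=N..<T. \<mu> t\<close> is at most the tail of that series from \<open>N\<close> on.  The choice \<open>N = 0\<close> gives the
  first rate (\<open>running_min_le\<close>); a large \<open>N\<close> together with the divergence of \<open>\<Sum>t. \<mu> t\<close> gives the
  second (\<open>running_min_smallo\<close>).\<close>

section \<open>Martingale differences and Kolmogorov's maximal inequality\<close>

lemma (in prob_space) integrable_bounded:
  fixes X :: "'a \<Rightarrow> real"
  assumes "X \<in> borel_measurable M" "bounded (X ` space M)"
  shows "integrable M X"
proof -
  obtain c where "\<And>\<omega>. \<omega> \<in> space M \<Longrightarrow> norm (X \<omega>) \<le> c"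
    using assms(2) unfolding bounded_iff by auto
  then show ?thesis
    using assms(1) by (intro integrable_const_bound[of _ c]) auto
qed

lemma bounded_image_times:
  fixes X Y :: "'a \<Rightarrow> real"
  assumes "bounded (X ` S)" "bounded (Y ` S)"
  shows "bounded ((\<lambda>\<omega>. X \<omega> * Y \<omega>) ` S)"
proof -
  obtain c d where cd: "\<And>\<omega>. \<omega> \<in> S \<Longrightarrow> \<bar>X \<omega>\<bar> \<le> c" "\<And>\<omega>. \<omega> \<in> S \<Longrightarrow> \<bar>Y \<omega>\<bar> \<le> d"
    using assms unfolding bounded_iff by auto
  have "\<bar>X \<omega> * Y \<omega>\<bar> \<le> c * d" if "\<omega> \<in> S" for \<omega>
    unfolding abs_mult using cd[OF that] by (intro mult_mono) auto
  then show ?thesis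
    unfolding bounded_iff by auto
qed

lemma bounded_image_sum:
  fixes X :: "'i \<Rightarrow> 'a \<Rightarrow> real"
  assumes "\<And>i. i \<in> I \<Longrightarrow> bounded (X i ` S)"
  shows "bounded ((\<lambda>\<omega>. \<Sum>i\<in>I. X i \<omega>) ` S)"
  using assms by (induction I rule: infinite_finite_induct) 
    (auto intro: bounded_plus_comp bounded_subset[OF bounded_insert[THEN iffD2, OF bounded_empty, of 0]])

locale filtered_prob_space = prob_space M for M :: "'a measure" +
  fixes F :: "nat \<Rightarrow> 'a measure"
  assumes F_subalgebra: "subalgebra M (F t)"
    and F_mono: "subalgebra (F (Suc t)) (F t)"
begin

lemma measurable_F_mono:
  assumes "X \<in> measurable (F s) N" "s \<le> t"
  shows "X \<in> measurable (F t) N"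
  using assms(2,1) by (induction rule: dec_induct) (auto intro: measurable_from_subalg[OF F_mono])

lemma measurable_F_imp_measurable: "X \<in> measurable (F t) N \<Longrightarrow> X \<in> measurable M N"
  by (rule measurable_from_subalg[OF F_subalgebra])

text \<open>For integrable \<open>D t\<close> the second clause says that the conditional expectation of \<open>D t\<close> given
  \<open>F t\<close> vanishes; it is put as orthogonality to the bounded functions of the past because this is
  the form in which cross terms of second moments are discarded.\<close>

definition martingale_difference :: "(nat \<Rightarrow> 'a \<Rightarrow> real) \<Rightarrow> bool" where
  "martingale_difference D \<longleftrightarrow>
     (\<forall>t. D t \<in> borel_measurable (F (Suc t))) \<and>
     (\<forall>t X. X \<in> borel_measurable (F t) \<longrightarrow> bounded (X ` space M) \<longrightarrow>
        expectation (\<lambda>\<omega>. X \<omega> * D t \<omega>) = 0)"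

lemma martingale_difference_adapted:
  "martingale_difference D \<Longrightarrow> D t \<in> borel_measurable (F (Suc t))"
  by (simp add: martingale_difference_def)

lemma martingale_difference_measurable:
  "martingale_difference D \<Longrightarrow> D t \<in> borel_measurable M"
  by (rule measurable_F_imp_measurable, rule martingale_difference_adapted)

lemma martingale_difference_orthogonal:
  "\<lbrakk>martingale_difference D; X \<in> borel_measurable (F t); bounded (X ` space M)\<rbrakk>
    \<Longrightarrow> expectation (\<lambda>\<omega>. X \<omega> * D t \<omega>) = 0"
  by (simp add: martingale_difference_def)

text \<open>The increments are pairwise orthogonal, also after multiplication with weights known beforehand,
  so the second moment of the weighted sum is the sum of the second moments.\<close>

lemma second_moment_martingale_transform:
  assumes D: "martingale_difference D" and D_bdd: "\<And>t. bounded (D t ` space M)"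
    and W: "\<And>t. W t \<in> borel_measurable (F t)" and W_le: "\<And>t \<omega>. \<bar>W t \<omega>\<bar> \<le> 1"
  shows "expectation (\<lambda>\<omega>. (\<Sum>t<n. W t \<omega> * D t \<omega>)\<^sup>2) \<le> (\<Sum>t<n. expectation (\<lambda>\<omega>. (D t \<omega>)\<^sup>2))"
proof (induction n)
  case 0
  then show ?case by simp
next
  case (Suc n)
  let ?S = "\<lambda>\<omega>. \<Sum>t<n. W t \<omega> * D t \<omega>"
  have W_bdd: "bounded (W t ` space M)" for t
    using W_le unfolding bounded_iff by (auto intro!: exI[of _ 1])
  have S: "?S \<in> borel_measurable (F n)"
    by (intro borel_measurable_sum borel_measurable_times)
      (auto intro: measurable_F_mono[OF W] measurable_F_mono[OF martingale_difference_adapted[OF D]])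
  have S_bdd: "bounded (?S ` space M)"
    by (intro bounded_image_sum bounded_image_times W_bdd D_bdd)
  have SW: "(\<lambda>\<omega>. ?S \<omega> * W n \<omega>) \<in> borel_measurable (F n)"
    using S W by measurable
  have SW_bdd: "bounded ((\<lambda>\<omega>. ?S \<omega> * W n \<omega>) ` space M)"
    by (intro bounded_image_times S_bdd W_bdd)
  note [measurable] = measurable_F_imp_measurable[OF S] measurable_F_imp_measurable[OF W]
    martingale_difference_measurable[OF D]
  have int1: "integrable M (\<lambda>\<omega>. (?S \<omega>)\<^sup>2)"
    by (intro integrable_bounded) (auto simp: power2_eq_square intro!: bounded_image_times S_bdd)
  have int2: "integrable M (\<lambda>\<omega>. (?S \<omega> * W n \<omega>) * D n \<omega>)"
    by (intro integrable_bounded) (auto intro!: bounded_image_times SW_bdd D_bdd)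
  have int3: "integrable M (\<lambda>\<omega>. (W n \<omega> * D n \<omega>)\<^sup>2)"
    by (intro integrable_bounded)
      (auto simp: power2_eq_square intro!: bounded_image_times W_bdd D_bdd)
  have int4: "integrable M (\<lambda>\<omega>. (D n \<omega>)\<^sup>2)"
    by (intro integrable_bounded) (auto simp: power2_eq_square intro!: bounded_image_times D_bdd)
  have "expectation (\<lambda>\<omega>. (\<Sum>t<Suc n. W t \<omega> * D t \<omega>)\<^sup>2)
      = expectation (\<lambda>\<omega>. ((?S \<omega>)\<^sup>2 + 2 * ((?S \<omega> * W n \<omega>) * D n \<omega>)) + (W n \<omega> * D n \<omega>)\<^sup>2)"
    by (intro Bochner_Integration.integral_cong) (auto simp: power2_eq_square algebra_simps)
  also have "\<dots> = expectation (\<lambda>\<omega>. (?S \<omega>)\<^sup>2) + 2 * expectation (\<lambda>\<omega>. (?S \<omega> * W n \<omega>) * D n \<omega>)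
      + expectation (\<lambda>\<omega>. (W n \<omega> * D n \<omega>)\<^sup>2)"
    using int1 int2 int3 by simp
  also have "expectation (\<lambda>\<omega>. (?S \<omega> * W n \<omega>) * D n \<omega>) = 0"
    by (rule martingale_difference_orthogonal[OF D SW SW_bdd])
  also have "expectation (\<lambda>\<omega>. (W n \<omega> * D n \<omega>)\<^sup>2) \<le> expectation (\<lambda>\<omega>. (D n \<omega>)\<^sup>2)"
  proof (intro integral_mono int3 int4)
    fix \<omega>
    have "(W n \<omega>)\<^sup>2 \<le> 1"
      using W_le[of n \<omega>] by (simp add: abs_square_le_1)
    then show "(W n \<omega> * D n \<omega>)\<^sup>2 \<le> (D n \<omega>)\<^sup>2"
      by (simp add: power_mult_distrib mult_left_le_one_le)
  qed
  finally show ?case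
    using Suc.IH by simp
qed

text \<open>Stop the partial sums as soon as they leave \<open>(-a, a)\<close>.  The stopped sum is a martingale transform
  with \<open>0\<close>-\<open>1\<close> weights, and it has absolute value at least \<open>a\<close> at time \<open>n\<close> whenever some earlier
  partial sum had; Markov's inequality for its square then gives the bound.\<close>

lemma Kolmogorov_maximal_inequality:
  assumes D: "martingale_difference D" and D_bdd: "\<And>t. bounded (D t ` space M)" and "0 < a"
  shows "prob {\<omega> \<in> space M. \<exists>k\<le>n. a \<le> \<bar>\<Sum>t<k. D t \<omega>\<bar>}
    \<le> (\<Sum>t<n. expectation (\<lambda>\<omega>. (D t \<omega>)\<^sup>2)) / a\<^sup>2"
proof -
  \<comment> \<open>\<open>W t\<close> indicates that the sums have stayed inside \<open>(-a, a)\<close> up to and including time \<open>t\<close>,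
    so the increment \<open>D t\<close> that makes them leave still counts.\<close>
  define W where "W t \<omega> = (if \<forall>k\<le>t. \<bar>\<Sum>s<k. D s \<omega>\<bar> < a then 1 else 0 :: real)" for t \<omega>
  define T where "T \<omega> = (\<Sum>t<n. W t \<omega> * D t \<omega>)" for \<omega>
  have W: "W t \<in> borel_measurable (F t)" for t
  proof -
    have [measurable]: "(\<lambda>\<omega>. \<Sum>s<k. D s \<omega>) \<in> borel_measurable (F t)" if "k \<le> t" for k
      using that by (intro borel_measurable_sum)
        (auto intro: measurable_F_mono[OF martingale_difference_adapted[OF D]])
    have "(\<lambda>\<omega>. \<forall>k\<in>{..t}. \<bar>\<Sum>s<k. D s \<omega>\<bar> < a) \<in> measurable (F t) (count_space UNIV)"
      by (rule pred_intros_finite) auto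
    then show ?thesis
      unfolding W_def Ball_def atMost_iff by measurable
  qed
  have W_le: "\<bar>W t \<omega>\<bar> \<le> 1" for t \<omega>
    by (simp add: W_def)
  have W_bdd: "bounded (W t ` space M)" for t
    using W_le unfolding bounded_iff by (auto intro!: exI[of _ 1])
  note [measurable] = measurable_F_imp_measurable[OF W] martingale_difference_measurable[OF D]
  have T_meas [measurable]: "T \<in> borel_measurable M"
    unfolding T_def by measurable
  have T_int: "integrable M (\<lambda>\<omega>. (T \<omega>)\<^sup>2)"
    unfolding T_def power2_eq_square
    by (intro integrable_bounded bounded_image_times bounded_image_sum W_bdd D_bdd) measurable
  have stopped: "a \<le> \<bar>T \<omega>\<bar>" if ex: "\<exists>k\<le>n. a \<le> \<bar>\<Sum>t<k. D t \<omega>\<bar>" for \<omega>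
  proof -
    define \<tau> where "\<tau> = (LEAST k. a \<le> \<bar>\<Sum>t<k. D t \<omega>\<bar>)"
    have \<tau>: "a \<le> \<bar>\<Sum>t<\<tau>. D t \<omega>\<bar>" and \<tau>_le: "\<tau> \<le> n"
      using ex unfolding \<tau>_def by (auto intro: LeastI Least_le[THEN order_trans])
    have before: "\<bar>\<Sum>s<k. D s \<omega>\<bar> < a" if "k < \<tau>" for k
      using not_less_Least[OF that[unfolded \<tau>_def]] by simp
    have "W t \<omega> = (if t < \<tau> then 1 else 0)" for t
      using \<tau> before by (auto simp: W_def not_less)
    then have "T \<omega> = (\<Sum>t<n. if t < \<tau> then D t \<omega> else 0)"
      unfolding T_def by (intro sum.cong) auto
    also have "\<dots> = (\<Sum>t<\<tau>. D t \<omega>)"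
      using \<tau>_le by (intro sum.mono_neutral_cong_right) auto
    finally show ?thesis
      using \<tau> by simp
  qed
  have "prob {\<omega> \<in> space M. \<exists>k\<le>n. a \<le> \<bar>\<Sum>t<k. D t \<omega>\<bar>} \<le> prob {\<omega> \<in> space M. a\<^sup>2 \<le> (T \<omega>)\<^sup>2}"
  proof (intro finite_measure_mono)
    show "{\<omega> \<in> space M. \<exists>k\<le>n. a \<le> \<bar>\<Sum>t<k. D t \<omega>\<bar>} \<subseteq> {\<omega> \<in> space M. a\<^sup>2 \<le> (T \<omega>)\<^sup>2}"
      using stopped \<open>0 < a\<close> by (auto simp: abs_le_square_iff[symmetric])
  qed measurable
  also have "\<dots> \<le> expectation (\<lambda>\<omega>. (T \<omega>)\<^sup>2) / a\<^sup>2"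
    using \<open>0 < a\<close> T_int by (intro integral_Markov_inequality_measure[where A="{}"]) auto
  also have "\<dots> \<le> (\<Sum>t<n. expectation (\<lambda>\<omega>. (D t \<omega>)\<^sup>2)) / a\<^sup>2"
    unfolding T_def by (intro divide_right_mono second_moment_martingale_transform D D_bdd W W_le) simp
  finally show ?thesis .
qed


text \<open>Passage to infinitely many times by continuity from below, for the sums that start at time \<open>m\<close>;
  the bound is a tail of a convergent series.\<close>

lemma prob_fluctuation_le:
  assumes D: "martingale_difference D" and D_bdd: "\<And>t. bounded (D t ` space M)" and "0 < a"
    and D_sum: "summable (\<lambda>t. expectation (\<lambda>\<omega>. (D t \<omega>)\<^sup>2))"
  shows "prob {\<omega> \<in> space M. \<exists>k. a \<le> \<bar>\<Sum>t<k. D (m + t) \<omega>\<bar>}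
    \<le> (\<Sum>t. expectation (\<lambda>\<omega>. (D (t + m) \<omega>)\<^sup>2)) / a\<^sup>2"
proof -
  interpret shifted: filtered_prob_space M "\<lambda>t. F (m + t)"
    by unfold_locales (auto simp: F_subalgebra F_mono)
  have D': "shifted.martingale_difference (\<lambda>t. D (m + t))"
    using D unfolding martingale_difference_def shifted.martingale_difference_def by simp
  define N where "N n = {\<omega> \<in> space M. \<exists>k\<le>n. a \<le> \<bar>\<Sum>t<k. D (m + t) \<omega>\<bar>}" for n
  note [measurable] = martingale_difference_measurable[OF D]
  have "N n \<in> events" for n
    unfolding N_def by measurable
  moreover have "incseq N"
    unfolding incseq_def N_def by (blast intro: order_trans)
  ultimately have "(\<lambda>n. prob (N n)) \<longlonglongrightarrow> prob (\<Union>n. N n)"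
    by (intro finite_Lim_measure_incseq) auto
  moreover have "prob (N n) \<le> (\<Sum>t. expectation (\<lambda>\<omega>. (D (t + m) \<omega>)\<^sup>2)) / a\<^sup>2" for n
  proof -
    have "prob (N n) \<le> (\<Sum>t<n. expectation (\<lambda>\<omega>. (D (m + t) \<omega>)\<^sup>2)) / a\<^sup>2"
      unfolding N_def by (rule shifted.Kolmogorov_maximal_inequality[OF D' D_bdd \<open>0 < a\<close>])
    also have "(\<Sum>t<n. expectation (\<lambda>\<omega>. (D (m + t) \<omega>)\<^sup>2)) \<le> (\<Sum>t. expectation (\<lambda>\<omega>. (D (t + m) \<omega>)\<^sup>2))"
      unfolding add.commute[of m]
      by (intro sum_le_suminf summable_ignore_initial_segment D_sum) auto
    finally show ?thesis
      by (simp add: divide_right_mono)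
  qed
  ultimately have "prob (\<Union>n. N n) \<le> (\<Sum>t. expectation (\<lambda>\<omega>. (D (t + m) \<omega>)\<^sup>2)) / a\<^sup>2"
    by (intro LIMSEQ_le_const2) auto
  moreover have "(\<Union>n. N n) = {\<omega> \<in> space M. \<exists>k. a \<le> \<bar>\<Sum>t<k. D (m + t) \<omega>\<bar>}"
    unfolding N_def by blast
  ultimately show ?thesis
    by simp
qed

text \<open>For each \<open>a > 0\<close>, the paths that after every time \<open>m\<close> still fluctuate by at least \<open>a\<close> form a null
  set, because the bound on the fluctuation after \<open>m\<close> tends to \<open>0\<close>.  Countably many values of \<open>a\<close>
  make the partial sums Cauchy almost surely.\<close>

theorem AE_summable_martingale_difference:
  assumes D: "martingale_difference D" and D_bdd: "\<And>t. bounded (D t ` space M)"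
    and D_sum: "summable (\<lambda>t. expectation (\<lambda>\<omega>. (D t \<omega>)\<^sup>2))"
  shows "AE \<omega> in M. summable (\<lambda>t. D t \<omega>)"
proof -
  note [measurable] = martingale_difference_measurable[OF D]
  have "AE \<omega> in M. \<exists>m. \<forall>k. \<bar>\<Sum>t<k. D (m + t) \<omega>\<bar> < a" if "0 < a" for a
  proof -
    define N where "N m = {\<omega> \<in> space M. \<exists>k. a \<le> \<bar>\<Sum>t<k. D (m + t) \<omega>\<bar>}" for m
    have N [measurable]: "N m \<in> events" for m
      unfolding N_def by measurable
    have "(\<lambda>m. (\<Sum>t. expectation (\<lambda>\<omega>. (D (t + m) \<omega>)\<^sup>2)) / a\<^sup>2) \<longlonglongrightarrow> 0 / a\<^sup>2"
      by (intro tendsto_divide tendsto_const suminf_exist_split2 D_sum) (use \<open>0 < a\<close> in auto)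
    moreover have "prob (\<Inter>m. N m) \<le> (\<Sum>t. expectation (\<lambda>\<omega>. (D (t + m) \<omega>)\<^sup>2)) / a\<^sup>2" for m
    proof -
      have "prob (\<Inter>m. N m) \<le> prob (N m)"
        by (intro finite_measure_mono) auto
      also have "\<dots> \<le> (\<Sum>t. expectation (\<lambda>\<omega>. (D (t + m) \<omega>)\<^sup>2)) / a\<^sup>2"
        unfolding N_def by (rule prob_fluctuation_le[OF D D_bdd \<open>0 < a\<close> D_sum])
      finally show ?thesis .
    qed
    ultimately have "prob (\<Inter>m. N m) \<le> 0"
      by (intro LIMSEQ_le_const) auto
    then have "prob (\<Inter>m. N m) = 0"
      using measure_nonneg[of M "\<Inter>m. N m"] by linarith
    then have "AE \<omega> in M. \<omega> \<notin> (\<Inter>m. N m)"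
      by (subst (asm) prob_eq_0) auto
    then show ?thesis
      by (rule AE_mp) (auto simp: N_def not_le intro!: AE_I2)
  qed
  then have "AE \<omega> in M. \<forall>j. \<exists>m. \<forall>k. \<bar>\<Sum>t<k. D (m + t) \<omega>\<bar> < inverse (real (Suc j))"
    by (simp add: AE_all_countable)
  then show ?thesis
  proof (rule AE_mp, intro AE_I2 impI)
    fix \<omega> assume small: "\<forall>j. \<exists>m. \<forall>k. \<bar>\<Sum>t<k. D (m + t) \<omega>\<bar> < inverse (real (Suc j))"
    show "summable (\<lambda>t. D t \<omega>)"
      unfolding summable_Cauchy
    proof (intro allI impI)
      fix e :: real assume "0 < e"
      then obtain j where j: "inverse (real (Suc j)) < e / 2"
        using reals_Archimedean[of "e / 2"] by auto
      obtain m0 where m0: "\<bar>\<Sum>t<k. D (m0 + t) \<omega>\<bar> < inverse (real (Suc j))" for k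
        using small by blast
      have "norm (\<Sum>t=m..<n. D t \<omega>) < e" if "m0 \<le> m" for m n
      proof (cases "m \<le> n")
        case True
        have shift: "(\<Sum>t<k - m0. D (m0 + t) \<omega>) = (\<Sum>t=m0..<k. D t \<omega>)" if "m0 \<le> k" for k
          using that sum.shift_bounds_nat_ivl[of "\<lambda>t. D t \<omega>" 0 m0 "k - m0"]
          by (simp add: atLeast0LessThan add.commute)
        have "(\<Sum>t=m..<n. D t \<omega>) = (\<Sum>t<n - m0. D (m0 + t) \<omega>) - (\<Sum>t<m - m0. D (m0 + t) \<omega>)"
          using True that by (simp add: shift sum.atLeastLessThan_concat[symmetric, of m0 m n])
        then show ?thesis
          using m0[of "n - m0"] m0[of "m - m0"] j unfolding real_norm_def by linarith
      next
        case False
        then show ?thesis using \<open>0 < e\<close> by simp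
      qed
      then show "\<exists>N. \<forall>m\<ge>N. \<forall>n. norm (\<Sum>t=m..<n. D t \<omega>) < e"
        by blast
    qed
  qed
qed

end

section \<open>Almost supermartingales\<close>

text \<open>Subtracting the partial sums of \<open>D\<close> from \<open>V\<close> leaves a decreasing sequence that is bounded below;
  what it loses in total dominates the sum of \<open>U\<close>.\<close>

lemma perturbed_decreasing_converges:
  fixes V U D :: "nat \<Rightarrow> real"
  assumes "\<And>t. 0 \<le> V t" "\<And>t. 0 \<le> U t" and step: "\<And>t. V (Suc t) \<le> V t - U t + D t"
    and D: "summable D"
  shows "convergent V" and "summable U"
proof -
  have D_lim: "(\<lambda>t. \<Sum>s<t. D s) \<longlonglongrightarrow> suminf D"
    by (rule summable_LIMSEQ[OF D])
  then obtain d where d: "\<bar>\<Sum>s<t. D s\<bar> \<le> d" for t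
    using convergentI[THEN convergent_imp_Bseq, OF D_lim] unfolding Bseq_def by auto
  have step': "V (Suc t) - (\<Sum>s<Suc t. D s) \<le> V t - (\<Sum>s<t. D s)" for t
    using step[of t] \<open>0 \<le> U t\<close> by simp
  have "convergent (\<lambda>t. V t - (\<Sum>s<t. D s))"
  proof (rule Bseq_monoseq_convergent)
    have "decseq (\<lambda>t. V t - (\<Sum>s<t. D s))"
      by (rule decseq_SucI) (rule step')
    then show "monoseq (\<lambda>t. V t - (\<Sum>s<t. D s))"
      by (rule decseq_imp_monoseq)
    have upper: "V t - (\<Sum>s<t. D s) \<le> V 0" for t
      using \<open>decseq _\<close> decseqD[of _ 0 t] by force
    have "\<bar>V t - (\<Sum>s<t. D s)\<bar> \<le> V 0 + d" for t
      using upper[of t] d[of t] assms(1)[of t] assms(1)[of 0] unfolding abs_le_iff by linarith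
    then show "Bseq (\<lambda>t. V t - (\<Sum>s<t. D s))"
      by (intro BseqI'[of _ "V 0 + d"]) simp
  qed
  then have "convergent (\<lambda>t. (V t - (\<Sum>s<t. D s)) + (\<Sum>s<t. D s))"
    using convergentI[OF D_lim] by (rule convergent_add)
  then show "convergent V"
    by simp
  have telescope: "(\<Sum>s<t. U s) \<le> V 0 - V t + (\<Sum>s<t. D s)" for t
  proof (induction t)
    case (Suc t)
    then show ?case using step[of t] by simp
  qed simp
  have "(\<Sum>s<t. U s) \<le> V 0 + d" for t
    using telescope[of t] d[of t] assms(1)[of t] unfolding abs_le_iff by linarith
  then show "summable U"
    using assms(2) by (intro summableI_nonneg_bounded)
qed

context filtered_prob_space
begin

text \<open>The noise is at most \<open>b t\<close> times the process itself, so the second moment of \<open>V\<close> grows in one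
  step by the factor \<open>1 + (b t)\<^sup>2\<close> at most (the cross term vanishes by orthogonality) and stays
  bounded.  Hence the noise has summable second moments and is summable along almost every path.\<close>

lemma AE_supermartingale_converges:
  assumes D: "martingale_difference D"
    and V_meas: "\<And>t. V t \<in> borel_measurable (F t)"
    and V_nonneg: "\<And>t \<omega>. \<omega> \<in> space M \<Longrightarrow> 0 \<le> V t \<omega>"
    and U_nonneg: "\<And>t \<omega>. \<omega> \<in> space M \<Longrightarrow> 0 \<le> U t \<omega>"
    and step: "\<And>t \<omega>. \<omega> \<in> space M \<Longrightarrow> V (Suc t) \<omega> \<le> V t \<omega> - U t \<omega> + D t \<omega>"
    and noise: "\<And>t \<omega>. \<omega> \<in> space M \<Longrightarrow> \<bar>D t \<omega>\<bar> \<le> b t * V t \<omega>"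
    and b: "\<And>t. 0 \<le> b t" "summable (\<lambda>t. (b t)\<^sup>2)"
    and V0: "bounded (V 0 ` space M)"
  shows "AE \<omega> in M. convergent (\<lambda>t. V t \<omega>) \<and> summable (\<lambda>t. U t \<omega>)"
proof -
  have D_le_bound: "bounded (D t ` space M)" if "bounded (V t ` space M)" for t
  proof -
    obtain c where c: "\<And>\<omega>. \<omega> \<in> space M \<Longrightarrow> \<bar>V t \<omega>\<bar> \<le> c"
      using \<open>bounded (V t ` space M)\<close> unfolding bounded_iff by auto
    have "\<bar>D t \<omega>\<bar> \<le> b t * c" if "\<omega> \<in> space M" for \<omega>
      using noise[OF that, of t] mult_left_mono[OF _ b(1)[of t], of "V t \<omega>" c] c[OF that] by linarith
    then show ?thesis
      unfolding bounded_iff by auto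
  qed
  have V_bdd: "bounded (V t ` space M)" for t
  proof (induction t)
    case (Suc t)
    have "bounded ((\<lambda>\<omega>. V t \<omega> + D t \<omega>) ` space M)"
      by (intro bounded_plus_comp D_le_bound Suc.IH)
    then obtain c where c: "\<And>\<omega>. \<omega> \<in> space M \<Longrightarrow> \<bar>V t \<omega> + D t \<omega>\<bar> \<le> c"
      unfolding bounded_iff by auto
    have "\<bar>V (Suc t) \<omega>\<bar> \<le> c" if "\<omega> \<in> space M" for \<omega>
      using c[OF that] step[OF that, of t] U_nonneg[OF that, of t] V_nonneg[OF that, of "Suc t"]
      by linarith
    then show ?case
      unfolding bounded_iff by auto
  qed (rule V0)
  have D_bdd: "bounded (D t ` space M)" for t
    by (rule D_le_bound[OF V_bdd])
  note [measurable] = martingale_difference_measurable[OF D] measurable_F_imp_measurable[OF V_meas]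
  have V2_int: "integrable M (\<lambda>\<omega>. (V t \<omega>)\<^sup>2)" and D2_int: "integrable M (\<lambda>\<omega>. (D t \<omega>)\<^sup>2)"
    and VD_int: "integrable M (\<lambda>\<omega>. V t \<omega> * D t \<omega>)" for t
    by (intro integrable_bounded; auto simp: power2_eq_square intro!: bounded_image_times V_bdd D_bdd)+
  have D2_le: "expectation (\<lambda>\<omega>. (D t \<omega>)\<^sup>2) \<le> (b t)\<^sup>2 * expectation (\<lambda>\<omega>. (V t \<omega>)\<^sup>2)" for t
  proof -
    have "(D t \<omega>)\<^sup>2 \<le> (b t)\<^sup>2 * (V t \<omega>)\<^sup>2" if "\<omega> \<in> space M" for \<omega>
      using power_mono[OF noise[OF that, of t], of 2] by (simp add: power_mult_distrib)
    then have "expectation (\<lambda>\<omega>. (D t \<omega>)\<^sup>2) \<le> expectation (\<lambda>\<omega>. (b t)\<^sup>2 * (V t \<omega>)\<^sup>2)"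
      by (intro integral_mono D2_int integrable_mult_right V2_int)
    then show ?thesis
      by simp
  qed
  have V2_step: "expectation (\<lambda>\<omega>. (V (Suc t) \<omega>)\<^sup>2) \<le> exp ((b t)\<^sup>2) * expectation (\<lambda>\<omega>. (V t \<omega>)\<^sup>2)" for t
  proof -
    have "(V (Suc t) \<omega>)\<^sup>2 \<le> ((V t \<omega>)\<^sup>2 + 2 * (V t \<omega> * D t \<omega>)) + (D t \<omega>)\<^sup>2" if "\<omega> \<in> space M" for \<omega>
    proof -
      have "(V (Suc t) \<omega>)\<^sup>2 \<le> (V t \<omega> + D t \<omega>)\<^sup>2"
        using step[OF that, of t] U_nonneg[OF that, of t] V_nonneg[OF that, of "Suc t"]
        by (intro power_mono) auto
      then show ?thesis
        by (simp add: power2_eq_square algebra_simps)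
    qed
    then have "expectation (\<lambda>\<omega>. (V (Suc t) \<omega>)\<^sup>2)
        \<le> expectation (\<lambda>\<omega>. ((V t \<omega>)\<^sup>2 + 2 * (V t \<omega> * D t \<omega>)) + (D t \<omega>)\<^sup>2)"
      by (intro integral_mono Bochner_Integration.integrable_add integrable_mult_right V2_int D2_int VD_int)
    also have "\<dots> = expectation (\<lambda>\<omega>. (V t \<omega>)\<^sup>2) + 2 * expectation (\<lambda>\<omega>. V t \<omega> * D t \<omega>)
        + expectation (\<lambda>\<omega>. (D t \<omega>)\<^sup>2)"
      using V2_int D2_int VD_int by simp
    also have "expectation (\<lambda>\<omega>. V t \<omega> * D t \<omega>) = 0"
      by (rule martingale_difference_orthogonal[OF D V_meas V_bdd])
    also have "expectation (\<lambda>\<omega>. (D t \<omega>)\<^sup>2) \<le> (b t)\<^sup>2 * expectation (\<lambda>\<omega>. (V t \<omega>)\<^sup>2)"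
      by (rule D2_le)
    also have "expectation (\<lambda>\<omega>. (V t \<omega>)\<^sup>2) + 2 * 0 + (b t)\<^sup>2 * expectation (\<lambda>\<omega>. (V t \<omega>)\<^sup>2)
        = (1 + (b t)\<^sup>2) * expectation (\<lambda>\<omega>. (V t \<omega>)\<^sup>2)"
      by (simp add: algebra_simps)
    also have "\<dots> \<le> exp ((b t)\<^sup>2) * expectation (\<lambda>\<omega>. (V t \<omega>)\<^sup>2)"
      by (intro mult_right_mono exp_ge_add_one_self) simp
    finally show ?thesis
      by simp
  qed
  have "expectation (\<lambda>\<omega>. (V t \<omega>)\<^sup>2) \<le> exp (\<Sum>s<t. (b s)\<^sup>2) * expectation (\<lambda>\<omega>. (V 0 \<omega>)\<^sup>2)" for t
  proof (induction t)
    case (Suc t)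
    then have "exp ((b t)\<^sup>2) * expectation (\<lambda>\<omega>. (V t \<omega>)\<^sup>2)
        \<le> exp ((b t)\<^sup>2) * (exp (\<Sum>s<t. (b s)\<^sup>2) * expectation (\<lambda>\<omega>. (V 0 \<omega>)\<^sup>2))"
      by (intro mult_left_mono) auto
    moreover have "exp (\<Sum>s<Suc t. (b s)\<^sup>2) = exp ((b t)\<^sup>2) * exp (\<Sum>s<t. (b s)\<^sup>2)"
      by (simp add: exp_add)
    ultimately show ?case
      using V2_step[of t] by (simp only: mult.assoc)
  qed simp
  moreover have "exp (\<Sum>s<t. (b s)\<^sup>2) \<le> exp (\<Sum>s. (b s)\<^sup>2)" for t
    using b(2) by (auto intro: sum_le_suminf)
  ultimately have V2_le: "expectation (\<lambda>\<omega>. (V t \<omega>)\<^sup>2)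
      \<le> exp (\<Sum>s. (b s)\<^sup>2) * expectation (\<lambda>\<omega>. (V 0 \<omega>)\<^sup>2)" (is "_ \<le> ?c") for t
    by (rule order_trans[OF _ mult_right_mono]) simp
  have "summable (\<lambda>t. expectation (\<lambda>\<omega>. (D t \<omega>)\<^sup>2))"
  proof (rule summable_comparison_test')
    show "summable (\<lambda>t. (b t)\<^sup>2 * ?c)"
      using b(2) by (rule summable_mult2)
    show "norm (expectation (\<lambda>\<omega>. (D t \<omega>)\<^sup>2)) \<le> (b t)\<^sup>2 * ?c" for t
      using order_trans[OF D2_le[of t] mult_left_mono[OF V2_le[of t]]] by simp
  qed
  from AE_summable_martingale_difference[OF D D_bdd this]
  show ?thesis
  proof (rule AE_mp, intro AE_I2 impI)
    fix \<omega> assume \<omega>: "\<omega> \<in> space M" and D_sum: "summable (\<lambda>t. D t \<omega>)"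
    show "convergent (\<lambda>t. V t \<omega>) \<and> summable (\<lambda>t. U t \<omega>)"
      using perturbed_decreasing_converges[of "\<lambda>t. V t \<omega>" "\<lambda>t. U t \<omega>" "\<lambda>t. D t \<omega>",
          OF V_nonneg[OF \<omega>] U_nonneg[OF \<omega>] step[OF \<omega>] D_sum] ..
  qed
qed

text \<open>A variant of the Robbins--Siegmund theorem.  Dividing \<open>V t\<close> by \<open>exp (\<Sum>s<t. a s)\<close> absorbs the growth
  factors \<open>1 + a t \<le> exp (a t)\<close>; these weights have a finite positive limit, so nothing is lost on
  going back.\<close>

theorem AE_almost_supermartingale_converges:
  assumes D: "martingale_difference D"
    and V_meas: "\<And>t. V t \<in> borel_measurable (F t)"
    and V_nonneg: "\<And>t \<omega>. \<omega> \<in> space M \<Longrightarrow> 0 \<le> V t \<omega>"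
    and U_nonneg: "\<And>t \<omega>. \<omega> \<in> space M \<Longrightarrow> 0 \<le> U t \<omega>"
    and step: "\<And>t \<omega>. \<omega> \<in> space M \<Longrightarrow> V (Suc t) \<omega> \<le> (1 + a t) * V t \<omega> - U t \<omega> + D t \<omega>"
    and noise: "\<And>t \<omega>. \<omega> \<in> space M \<Longrightarrow> \<bar>D t \<omega>\<bar> \<le> b t * V t \<omega>"
    and a: "\<And>t. 0 \<le> a t" "summable a"
    and b: "\<And>t. 0 \<le> b t" "summable (\<lambda>t. (b t)\<^sup>2)"
    and V0: "bounded (V 0 ` space M)"
  shows "AE \<omega> in M. convergent (\<lambda>t. V t \<omega>) \<and> summable (\<lambda>t. U t \<omega>)"
proof -
  define w where "w t = exp (- (\<Sum>s<t. a s))" for t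
  have w_pos: "0 < w t" for t
    by (simp add: w_def)
  have w_Suc: "w (Suc t) * (1 + a t) \<le> w t" for t
  proof -
    have "w (Suc t) * (1 + a t) \<le> w (Suc t) * exp (a t)"
      using w_pos[of "Suc t"] by (intro mult_left_mono exp_ge_add_one_self) simp
    also have "\<dots> = w t"
      by (simp add: w_def exp_add[symmetric])
    finally show ?thesis .
  qed
  have w_anti: "w (Suc t) \<le> w t" for t
    using a(1) by (simp add: w_def)
  have w_lim: "(\<lambda>t. inverse (w t)) \<longlonglongrightarrow> exp (suminf a)"
    unfolding w_def exp_minus inverse_inverse_eq
    by (intro tendsto_exp summable_LIMSEQ a(2))
  have w_ge: "exp (- suminf a) \<le> w t" for t
    unfolding w_def using a by (auto intro: sum_le_suminf)
  have "AE \<omega> in M. convergent (\<lambda>t. w t * V t \<omega>) \<and> summable (\<lambda>t. w (Suc t) * U t \<omega>)"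
  proof (rule AE_supermartingale_converges[where D = "\<lambda>t \<omega>. w (Suc t) * D t \<omega>"])
    show "martingale_difference (\<lambda>t \<omega>. w (Suc t) * D t \<omega>)"
      using D unfolding martingale_difference_def
      by (auto simp: mult.left_commute[of _ "w _"] intro!: borel_measurable_times)
    show "(\<lambda>\<omega>. w t * V t \<omega>) \<in> borel_measurable (F t)" for t
      by (intro borel_measurable_times borel_measurable_const V_meas)
    show "summable (\<lambda>t. (b t)\<^sup>2)" "0 \<le> b t" for t
      by (fact b)+
    show "bounded ((\<lambda>\<omega>. w 0 * V 0 \<omega>) ` space M)"
      using V0 by (simp add: w_def)
  next
    fix t \<omega> assume \<omega>: "\<omega> \<in> space M"
    show "0 \<le> w t * V t \<omega>" "0 \<le> w (Suc t) * U t \<omega>"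
      using w_pos[of t] w_pos[of "Suc t"] V_nonneg[OF \<omega>] U_nonneg[OF \<omega>] by simp_all
    have "w (Suc t) * V (Suc t) \<omega> \<le> w (Suc t) * ((1 + a t) * V t \<omega> - U t \<omega> + D t \<omega>)"
      using step[OF \<omega>] w_pos[of "Suc t"] by (intro mult_left_mono) auto
    also have "\<dots> = (w (Suc t) * (1 + a t)) * V t \<omega> - w (Suc t) * U t \<omega> + w (Suc t) * D t \<omega>"
      by (simp add: algebra_simps)
    also have "\<dots> \<le> w t * V t \<omega> - w (Suc t) * U t \<omega> + w (Suc t) * D t \<omega>"
      using mult_right_mono[OF w_Suc V_nonneg[OF \<omega>]] by simp
    finally show "w (Suc t) * V (Suc t) \<omega> \<le> w t * V t \<omega> - w (Suc t) * U t \<omega> + w (Suc t) * D t \<omega>" .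
    have "\<bar>w (Suc t) * D t \<omega>\<bar> = w (Suc t) * \<bar>D t \<omega>\<bar>"
      using w_pos[of "Suc t"] by (simp add: abs_mult)
    also have "\<dots> \<le> w t * (b t * V t \<omega>)"
      using w_anti w_pos[of t] noise[OF \<omega>] by (intro mult_mono) auto
    finally show "\<bar>w (Suc t) * D t \<omega>\<bar> \<le> b t * (w t * V t \<omega>)"
      by (simp add: mult_ac)
  qed
  then show ?thesis
  proof (rule AE_mp, intro AE_I2 impI conjI)
    fix \<omega> assume \<omega>: "\<omega> \<in> space M"
      and conv: "convergent (\<lambda>t. w t * V t \<omega>) \<and> summable (\<lambda>t. w (Suc t) * U t \<omega>)"
    then have "convergent (\<lambda>t. inverse (w t) * (w t * V t \<omega>))"
      by (intro convergent_mult[OF convergentI[OF w_lim]]) simp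
    moreover have "inverse (w t) * (w t * V t \<omega>) = V t \<omega>" for t
      using w_pos[of t] by simp
    ultimately show "convergent (\<lambda>t. V t \<omega>)"
      by simp
    show "summable (\<lambda>t. U t \<omega>)"
    proof (rule summable_comparison_test')
      show "summable (\<lambda>t. exp (suminf a) * (w (Suc t) * U t \<omega>))"
        using conv by (intro summable_mult) simp
      have "exp (suminf a) * exp (- suminf a) * U t \<omega> \<le> exp (suminf a) * w (Suc t) * U t \<omega>" for t
        using w_ge U_nonneg[OF \<omega>] by (intro mult_right_mono mult_left_mono) auto
      then show "norm (U t \<omega>) \<le> exp (suminf a) * (w (Suc t) * U t \<omega>)" for t
        using U_nonneg[OF \<omega>] by (simp add: exp_add[symmetric] mult.assoc)
    qed
  qed
qed

end

section \<open>Descent of the amplitude loss\<close>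

text \<open>One formula covers both branches of the Wirtinger gradient: for \<open>\<epsilon> = 0\<close> the quotient
  \<open>u / \<bar>u\<bar>\<close> is \<open>sgn u\<close>, also at \<open>u = 0\<close> since \<open>0 / 0 = 0\<close>.\<close>

definition amp_residual :: "real \<Rightarrow> real \<Rightarrow> complex \<Rightarrow> complex" where
  "amp_residual \<epsilon> \<eta> u =
     u - of_real (sqrt (\<eta> + \<epsilon>)) * u / of_real (sqrt ((cmod u)\<^sup>2 + \<epsilon>))"

text \<open>The Cauchy--Schwarz inequality for the vectors \<open>u\<close> and \<open>v\<close>, each extended by one further
  coordinate \<open>sqrt \<epsilon>\<close>.\<close>

lemma inner_add_le_sqrt:
  fixes u v :: "'a::real_inner"
  assumes "0 \<le> \<epsilon>"
  shows "inner u v + \<epsilon> \<le> sqrt ((norm u)\<^sup>2 + \<epsilon>) * sqrt ((norm v)\<^sup>2 + \<epsilon>)"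
proof -
  have "0 \<le> \<epsilon> * (norm u - norm v)\<^sup>2"
    using assms by simp
  then have "(norm u * norm v + \<epsilon>)\<^sup>2 \<le> ((norm u)\<^sup>2 + \<epsilon>) * ((norm v)\<^sup>2 + \<epsilon>)"
    by (simp add: power2_eq_square algebra_simps)
  then have "norm u * norm v + \<epsilon> \<le> sqrt (((norm u)\<^sup>2 + \<epsilon>) * ((norm v)\<^sup>2 + \<epsilon>))"
    by (rule real_le_rsqrt)
  then show ?thesis
    using norm_cauchy_schwarz[of u v] by (simp add: real_sqrt_mult)
qed

lemma inner_amp_residual:
  "inner (amp_residual \<epsilon> \<eta> u) h
     = inner u h - sqrt (\<eta> + \<epsilon>) * (inner u h / sqrt ((cmod u)\<^sup>2 + \<epsilon>))"
proof -
  have "of_real (sqrt (\<eta> + \<epsilon>)) * u / of_real (sqrt ((cmod u)\<^sup>2 + \<epsilon>))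
      = (sqrt (\<eta> + \<epsilon>) / sqrt ((cmod u)\<^sup>2 + \<epsilon>)) *\<^sub>R u"
    by (simp add: scaleR_conv_of_real)
  then show ?thesis
    by (simp add: amp_residual_def inner_diff_left)
qed

text \<open>Expanding the squares, the quadratic parts agree exactly, and what remains is
  \<open>- 2 * sqrt (\<eta> + \<epsilon>)\<close> times the increment of the convex function \<open>\<lambda>u. sqrt ((cmod u)\<^sup>2 + \<epsilon>)\<close>, which lies
  above its linearization.  At \<open>u = 0\<close>, \<open>\<epsilon> = 0\<close> the value \<open>sgn 0 = 0\<close> picks the subgradient \<open>0\<close>.\<close>

lemma scalar_amp_loss_descent:
  assumes "0 \<le> \<epsilon>" "0 \<le> \<eta>"
  shows "(sqrt ((cmod (u + h))\<^sup>2 + \<epsilon>) - sqrt (\<eta> + \<epsilon>))\<^sup>2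
    \<le> (sqrt ((cmod u)\<^sup>2 + \<epsilon>) - sqrt (\<eta> + \<epsilon>))\<^sup>2 + 2 * inner (amp_residual \<epsilon> \<eta> u) h + (cmod h)\<^sup>2"
proof -
  define s a b where "s = sqrt (\<eta> + \<epsilon>)" and "a = sqrt ((cmod u)\<^sup>2 + \<epsilon>)"
    and "b = sqrt ((cmod (u + h))\<^sup>2 + \<epsilon>)"
  have "0 \<le> s" "0 \<le> a" "0 \<le> b"
    using assms by (simp_all add: s_def a_def b_def)
  have a2: "a\<^sup>2 = (cmod u)\<^sup>2 + \<epsilon>" and b2: "b\<^sup>2 = (cmod (u + h))\<^sup>2 + \<epsilon>"
    using assms by (simp_all add: a_def b_def)
  have uh2: "(cmod (u + h))\<^sup>2 = (cmod u)\<^sup>2 + 2 * inner u h + (cmod h)\<^sup>2"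
    by (simp add: power2_norm_eq_inner inner_add_left inner_add_right inner_commute)
  have "inner u h / a \<le> b - a"
  proof (cases "a = 0")
    case False
    have "(cmod u)\<^sup>2 + inner u h + \<epsilon> \<le> a * b"
      using inner_add_le_sqrt[OF \<open>0 \<le> \<epsilon>\<close>, of u "u + h"]
      by (simp add: a_def b_def inner_add_right power2_norm_eq_inner)
    then have "inner u h \<le> (b - a) * a"
      using a2 by (simp add: power2_eq_square algebra_simps)
    then show ?thesis
      using False \<open>0 \<le> a\<close> by (simp add: divide_le_eq)
  qed (use \<open>0 \<le> b\<close> in simp)
  then have "s * (inner u h / a) \<le> s * (b - a)"
    using \<open>0 \<le> s\<close> by (rule mult_left_mono)
  then have "s * (inner u h / a) \<le> s * b - s * a"
    by (simp only: right_diff_distrib)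
  moreover have "(b - s)\<^sup>2 = b\<^sup>2 - 2 * (s * b) + s\<^sup>2" "(a - s)\<^sup>2 = a\<^sup>2 - 2 * (s * a) + s\<^sup>2"
    by (simp_all add: power2_diff)
  ultimately have "(b - s)\<^sup>2 \<le> (a - s)\<^sup>2 + 2 * (inner u h - s * (inner u h / a)) + (cmod h)\<^sup>2"
    using a2 b2 uh2 by argo
  then show ?thesis
    unfolding inner_amp_residual s_def a_def b_def .
qed

text \<open>The residual is \<open>u\<close> times \<open>1 - sqrt (\<eta> + \<epsilon>) / sqrt ((cmod u)\<^sup>2 + \<epsilon>)\<close>, and
  \<open>cmod u \<le> sqrt ((cmod u)\<^sup>2 + \<epsilon>)\<close>.\<close>

lemma norm_amp_residual_le:
  assumes "0 \<le> \<epsilon>"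
  shows "(cmod (amp_residual \<epsilon> \<eta> u))\<^sup>2 \<le> (sqrt ((cmod u)\<^sup>2 + \<epsilon>) - sqrt (\<eta> + \<epsilon>))\<^sup>2"
proof -
  define s a where "s = sqrt (\<eta> + \<epsilon>)" and "a = sqrt ((cmod u)\<^sup>2 + \<epsilon>)"
  have a2: "a\<^sup>2 = (cmod u)\<^sup>2 + \<epsilon>"
    using assms by (simp add: a_def)
  show ?thesis
  proof (cases "a = 0")
    case True
    then have "u = 0"
      using a2 assms by (simp add: add_nonneg_eq_0_iff)
    then show ?thesis
      by (simp add: amp_residual_def)
  next
    case False
    have "amp_residual \<epsilon> \<eta> u = ((a - s) / a) *\<^sub>R u"
      using False unfolding amp_residual_def s_def[symmetric] a_def[symmetric]
      by (simp add: scaleR_conv_of_real field_simps)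
    then have "(cmod (amp_residual \<epsilon> \<eta> u))\<^sup>2 = (a - s)\<^sup>2 * ((cmod u)\<^sup>2 / a\<^sup>2)"
      by (simp add: power_mult_distrib power_divide)
    also have "\<dots> \<le> (a - s)\<^sup>2 * 1"
    proof (intro mult_left_mono)
      show "(cmod u)\<^sup>2 / a\<^sup>2 \<le> 1"
        using assms False by (intro divide_le_eq_1_pos[THEN iffD2]) (simp_all add: a2[symmetric], simp add: a2)
    qed simp
    finally show ?thesis
      by (simp add: s_def a_def)
  qed
qed

definition amp_residual_vec :: "real \<Rightarrow> complex^'d^'m \<Rightarrow> real^'m \<Rightarrow> complex^'d \<Rightarrow> complex^'m" where
  "amp_residual_vec \<epsilon> A y z = (\<chi> j. amp_residual \<epsilon> (y $ j) ((A *v z) $ j))"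

lemma amp_grad_eq:
  assumes "0 \<le> \<epsilon>"
  shows "amp_grad \<epsilon> A y z = cadjoint A *v amp_residual_vec \<epsilon> A y z"
proof (cases "\<epsilon> > 0")
  case True
  have "A *v z - (\<chi> j. of_real (sqrt (y $ j + \<epsilon>)) * (A *v z) $ j
      / of_real (sqrt ((cmod ((A *v z) $ j))\<^sup>2 + \<epsilon>))) = amp_residual_vec \<epsilon> A y z"
    by (simp add: vec_eq_iff amp_residual_vec_def amp_residual_def)
  then show ?thesis
    using True by (simp add: amp_grad_def)
next
  case False
  with assms have "\<epsilon> = 0"
    by simp
  have "A *v z - (\<chi> j. of_real (sqrt (y $ j)) * sgn ((A *v z) $ j)) = amp_residual_vec 0 A y z"
    by (simp add: vec_eq_iff amp_residual_vec_def amp_residual_def sgn_eq)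
  then show ?thesis
    unfolding \<open>\<epsilon> = 0\<close> by (simp add: amp_grad_def)
qed

text \<open>Masking the residuals instead of the rows of \<open>A\<close> leaves one and the same adjoint for all blocks,
  so that block gradients add up to the full gradient and are bounded uniformly in the block.\<close>

lemma block_grad_eq:
  assumes "0 \<le> \<epsilon>"
  shows "block_grad \<epsilon> A y S z = cadjoint A *v row_block S (amp_residual_vec \<epsilon> A y z)"
proof -
  have "block_grad \<epsilon> A y S z $ k = (cadjoint A *v row_block S (amp_residual_vec \<epsilon> A y z)) $ k" for k
  proof -
    have "(cadjoint A *v row_block S (amp_residual_vec \<epsilon> A y z)) $ k
        = (\<Sum>j\<in>UNIV. if j \<in> S then cnj (A $ j $ k) * amp_residual \<epsilon> (y $ j) ((A *v z) $ j) else 0)"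
      unfolding cadjoint_mult by (intro sum.cong) (auto simp: row_block_def amp_residual_vec_def)
    also have "\<dots> = (\<Sum>j\<in>S. cnj (A $ j $ k) * amp_residual \<epsilon> (y $ j) ((A *v z) $ j))"
      by (simp add: sum.If_cases)
    also have "\<dots> = block_grad \<epsilon> A y S z $ k"
      using assms unfolding amp_grad_row_block
      by (intro sum.cong) (auto simp: amp_residual_def sgn_eq)
    finally show ?thesis ..
  qed
  then show ?thesis
    by (simp add: vec_eq_iff)
qed

lemma sum_row_block:
  fixes v :: "('a::comm_monoid_add)^'m"
  assumes "is_row_partition R B"
  shows "(\<Sum>s\<in>{1..R}. row_block (B s) v) = v"
proof -
  have "(\<Sum>s\<in>{1..R}. row_block (B s) v) $ j = v $ j" for j
  proof -
    obtain s where s: "s \<in> {1..R}" "j \<in> B s"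
      using assms unfolding is_row_partition_def by blast
    have uniq: "j \<in> B s' \<longleftrightarrow> s' = s" if "s' \<in> {1..R}" for s'
      using assms s that unfolding is_row_partition_def disjoint_family_on_def by blast
    have "(\<Sum>s'\<in>{1..R}. row_block (B s') v $ j) = (\<Sum>s'\<in>{1..R}. if s' = s then v $ j else 0)"
    proof (rule sum.cong)
      show "row_block (B s') v $ j = (if s' = s then v $ j else 0)" if "s' \<in> {1..R}" for s'
        unfolding row_block_def by (simp add: uniq[OF that])
    qed simp
    then show ?thesis
      using s by simp
  qed
  then show ?thesis
    by (simp add: vec_eq_iff)
qed

lemma sum_block_grad:
  assumes "0 \<le> \<epsilon>" "is_row_partition R B"
  shows "(\<Sum>s\<in>{1..R}. block_grad \<epsilon> A y (B s) z) = amp_grad \<epsilon> A y z"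
  unfolding block_grad_eq[OF assms(1)] amp_grad_eq[OF assms(1)]
  by (simp only: linear_sum[OF bounded_linear.linear[OF matrix_vector_mul_bounded_linear], symmetric]
      sum_row_block[OF assms(2)])

lemma inner_cadjoint: "inner (cadjoint A *v w) z = inner w (A *v z)"
proof -
  have "inner (cadjoint A *v w) z = (\<Sum>k\<in>UNIV. \<Sum>j\<in>UNIV. inner (cnj (A $ j $ k) * w $ j) (z $ k))"
    by (simp add: inner_vec_def cadjoint_mult inner_sum_left)
  also have "\<dots> = (\<Sum>j\<in>UNIV. \<Sum>k\<in>UNIV. inner (w $ j) (A $ j $ k * z $ k))"
    by (subst sum.swap) (simp add: inner_complex_def algebra_simps)
  also have "\<dots> = inner w (A *v z)"
    by (simp add: inner_vec_def matrix_vector_mult_def inner_sum_right)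
  finally show ?thesis .
qed

lemma spectral_norm_nonneg: "0 \<le> spectral_norm A"
  unfolding spectral_norm_def by (rule onorm_pos_le[OF matrix_vector_mul_bounded_linear])

lemma norm_mult_le_spectral_norm: "norm (A *v v) \<le> spectral_norm A * norm v"
  unfolding spectral_norm_def by (rule onorm[OF matrix_vector_mul_bounded_linear])

text \<open>Pair \<open>cadjoint A *v w\<close> with itself and move \<open>A\<close> to the other side.\<close>

lemma norm_cadjoint_mult_le: "norm (cadjoint A *v w) \<le> spectral_norm A * norm w"
proof (cases "cadjoint A *v w = 0")
  case False
  have "norm (cadjoint A *v w) * norm (cadjoint A *v w) = inner w (A *v (cadjoint A *v w))"
    by (simp add: inner_cadjoint[symmetric] power2_norm_eq_inner[symmetric] power2_eq_square)
  also have "\<dots> \<le> norm w * norm (A *v (cadjoint A *v w))"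
    by (rule norm_cauchy_schwarz)
  also have "\<dots> \<le> norm w * (spectral_norm A * norm (cadjoint A *v w))"
    by (intro mult_left_mono norm_mult_le_spectral_norm) simp
  finally show ?thesis
    using False by (simp add: mult_ac)
qed (simp add: spectral_norm_nonneg)

lemma amp_loss_nonneg: "0 \<le> amp_loss \<epsilon> A y z"
  by (simp add: amp_loss_def)

text \<open>The loss has a global quadratic upper model, although it is not differentiable everywhere when
  \<open>\<epsilon> = 0\<close>: sum the scalar inequality over the measurements.\<close>

lemma amp_loss_descent:
  assumes "0 \<le> \<epsilon>" "\<forall>j. 0 \<le> y $ j"
  shows "amp_loss \<epsilon> A y (z + h)
    \<le> amp_loss \<epsilon> A y z + 2 * inner (amp_grad \<epsilon> A y z) h + (norm (A *v h))\<^sup>2"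
proof -
  have "amp_loss \<epsilon> A y (z + h) \<le> (\<Sum>j\<in>UNIV.
      (sqrt ((cmod ((A *v z) $ j))\<^sup>2 + \<epsilon>) - sqrt (y $ j + \<epsilon>))\<^sup>2
      + 2 * inner (amp_residual_vec \<epsilon> A y z $ j) ((A *v h) $ j) + (cmod ((A *v h) $ j))\<^sup>2)"
    unfolding amp_loss_sum amp_residual_vec_def
    using assms by (intro sum_mono) (simp add: matrix_vector_right_distrib scalar_amp_loss_descent)
  also have "\<dots> = amp_loss \<epsilon> A y z + 2 * inner (amp_residual_vec \<epsilon> A y z) (A *v h) + (norm (A *v h))\<^sup>2"
    by (simp add: sum.distrib amp_loss_sum inner_vec_def sum_distrib_left power2_norm_eq_inner)
  finally show ?thesis
    by (simp add: amp_grad_eq[OF assms(1)] inner_cadjoint)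
qed

lemma norm_amp_residual_vec_le:
  assumes "0 \<le> \<epsilon>"
  shows "norm (amp_residual_vec \<epsilon> A y z) \<le> sqrt (amp_loss \<epsilon> A y z)"
proof (rule real_le_rsqrt)
  have "(norm (amp_residual_vec \<epsilon> A y z))\<^sup>2
      = (\<Sum>j\<in>UNIV. (cmod (amp_residual \<epsilon> (y $ j) ((A *v z) $ j)))\<^sup>2)"
    by (simp add: norm_vec_def L2_set_def sum_nonneg amp_residual_vec_def)
  also have "\<dots> \<le> amp_loss \<epsilon> A y z"
    unfolding amp_loss_sum by (intro sum_mono norm_amp_residual_le assms)
  finally show "(norm (amp_residual_vec \<epsilon> A y z))\<^sup>2 \<le> amp_loss \<epsilon> A y z" .
qed

lemma norm_block_grad_le:
  assumes "0 \<le> \<epsilon>"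
  shows "norm (block_grad \<epsilon> (A :: complex^'d^'b) y S z) \<le> spectral_norm A * sqrt (amp_loss \<epsilon> A y z)"
proof -
  have "norm (row_block S v) \<le> norm v" for v :: "complex^'b"
    unfolding norm_vec_def by (intro L2_set_mono) (auto simp: row_block_def)
  then have "norm (row_block S (amp_residual_vec \<epsilon> A y z)) \<le> sqrt (amp_loss \<epsilon> A y z)"
    using norm_amp_residual_vec_le[OF assms] by (rule order_trans)
  then have "spectral_norm A * norm (row_block S (amp_residual_vec \<epsilon> A y z))
      \<le> spectral_norm A * sqrt (amp_loss \<epsilon> A y z)"
    by (rule mult_left_mono[OF _ spectral_norm_nonneg])
  then show ?thesis
    unfolding block_grad_eq[OF assms] by (rule order_trans[OF norm_cadjoint_mult_le])
qed

lemma norm_amp_grad_le: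
  assumes "0 \<le> \<epsilon>"
  shows "norm (amp_grad \<epsilon> A y z) \<le> spectral_norm A * sqrt (amp_loss \<epsilon> A y z)"
  unfolding amp_grad_eq[OF assms]
  by (rule order_trans[OF norm_cadjoint_mult_le])
    (intro mult_left_mono norm_amp_residual_vec_le assms spectral_norm_nonneg)

text \<open>Whatever blocks are drawn, the stochastic gradient is of the order of the square root of the loss.
  This pathwise bound controls the quadratic term of the descent as well as the size of the noise.
  The factor \<open>\<Sum>s. 1 / p s\<close> is a convenient upper bound for every single importance weight.\<close>

lemma norm_stoch_grad_le:
  assumes "0 \<le> \<epsilon>" and p: "\<forall>s\<in>{1..R}. 0 < p s" and "1 \<le> K" and i: "\<forall>k\<in>{1..K}. i k \<in> {1..R}"
  shows "norm (stoch_grad \<epsilon> A y B p K i z)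
    \<le> (\<Sum>s\<in>{1..R}. 1 / p s) * (spectral_norm A * sqrt (amp_loss \<epsilon> A y z))"
    (is "_ \<le> ?q * ?g")
proof -
  have "norm ((1 / p (i k)) *\<^sub>R block_grad \<epsilon> A y (B (i k)) z) \<le> ?q * ?g" if "k \<in> {1..K}" for k
  proof -
    have "i k \<in> {1..R}"
      using i that by blast
    then have "1 / p (i k) \<le> ?q"
      using p by (intro member_le_sum) (auto simp: less_imp_le)
    moreover have "0 < p (i k)"
      using p \<open>i k \<in> {1..R}\<close> by blast
    ultimately have "1 / p (i k) * norm (block_grad \<epsilon> A y (B (i k)) z) \<le> ?q * ?g"
      using norm_block_grad_le[OF \<open>0 \<le> \<epsilon>\<close>]
      by (intro mult_mono) (auto intro: order_trans[of 0 "1 / p (i k)"])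
    then show ?thesis
      using \<open>0 < p (i k)\<close> by simp
  qed
  then have "norm (\<Sum>k\<in>{1..K}. (1 / p (i k)) *\<^sub>R block_grad \<epsilon> A y (B (i k)) z) \<le> real K * (?q * ?g)"
    using sum_norm_bound[of "{1..K}" "\<lambda>k. (1 / p (i k)) *\<^sub>R block_grad \<epsilon> A y (B (i k)) z" "?q * ?g"]
    by simp
  then show ?thesis
    using \<open>1 \<le> K\<close> by (simp add: stoch_grad_def divide_le_eq mult_ac)
qed

lemma amp_loss_stochastic_step:
  assumes "0 \<le> \<epsilon>" "\<forall>j. 0 \<le> y $ j"
    and p: "\<forall>s\<in>{1..R}. 0 < p s" and "1 \<le> K" and i: "\<forall>k\<in>{1..K}. i k \<in> {1..R}"
  shows "amp_loss \<epsilon> A y (z - m *\<^sub>R stoch_grad \<epsilon> A y B p K i z)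
    \<le> (1 + ((spectral_norm A)\<^sup>2 * (\<Sum>s\<in>{1..R}. 1 / p s))\<^sup>2 * m\<^sup>2) * amp_loss \<epsilon> A y z
      - 2 * m * inner (amp_grad \<epsilon> A y z) (stoch_grad \<epsilon> A y B p K i z)"
proof -
  let ?g = "stoch_grad \<epsilon> A y B p K i z" and ?q = "\<Sum>s\<in>{1..R}. 1 / p s"
  have "norm (A *v ?g) \<le> spectral_norm A * (?q * (spectral_norm A * sqrt (amp_loss \<epsilon> A y z)))"
    by (rule order_trans[OF norm_mult_le_spectral_norm])
      (intro mult_left_mono norm_stoch_grad_le assms spectral_norm_nonneg)
  then have "(norm (A *v ?g))\<^sup>2
      \<le> (spectral_norm A * (?q * (spectral_norm A * sqrt (amp_loss \<epsilon> A y z))))\<^sup>2"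
    by (rule power_mono) simp
  also have "\<dots> = ((spectral_norm A)\<^sup>2 * ?q)\<^sup>2 * amp_loss \<epsilon> A y z"
  proof -
    have "(a * (q * (a * r)))\<^sup>2 = (a\<^sup>2 * q)\<^sup>2 * r\<^sup>2" for a q r :: real
      by (simp only: power2_eq_square mult_ac)
    then show ?thesis
      by (simp only: real_sqrt_pow2[OF amp_loss_nonneg])
  qed
  finally have Ag: "m\<^sup>2 * (norm (A *v ?g))\<^sup>2 \<le> m\<^sup>2 * (((spectral_norm A)\<^sup>2 * ?q)\<^sup>2 * amp_loss \<epsilon> A y z)"
    by (rule mult_left_mono) simp
  have lin: "linear ((*v) A)"
    by (rule bounded_linear.linear[OF matrix_vector_mul_bounded_linear])
  have "A *v (- (m *\<^sub>R ?g)) = - (m *\<^sub>R (A *v ?g))"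
    by (simp only: linear_neg[OF lin] linear_cmul[OF lin])
  then have "(norm (A *v (- (m *\<^sub>R ?g))))\<^sup>2 = m\<^sup>2 * (norm (A *v ?g))\<^sup>2"
    by (simp add: power_mult_distrib)
  then show ?thesis
    using amp_loss_descent[OF assms(1,2), of A z "- (m *\<^sub>R ?g)"] Ag
    by (simp add: distrib_left mult_ac)
qed

section \<open>Random draws and their past\<close>

locale index_sampling = prob_space M for M :: "'w measure" +
  fixes R K :: nat and p :: "nat \<Rightarrow> real" and r :: "nat \<Rightarrow> nat \<Rightarrow> 'w \<Rightarrow> nat"
  assumes indep: "indep_vars (\<lambda>_. count_space {1..R}) (\<lambda>(t, k). r t k) (UNIV \<times> {1..K})"
    and distr: "\<lbrakk>k \<in> {1..K}; s \<in> {1..R}\<rbrakk> \<Longrightarrow> prob {\<omega> \<in> space M. r t k \<omega> = s} = p s"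
    and p_pos: "s \<in> {1..R} \<Longrightarrow> 0 < p s"
begin

definition draws_before :: "nat \<Rightarrow> (nat \<times> nat) set" where
  "draws_before t = {..<t} \<times> {1..K}"

text \<open>The draws made before time \<open>t\<close>, cut off to an extensional function so that they form a random
  variable with values in a finite set.  Every function of the history is then measurable and
  bounded.  This settles the measurability of the iterates and of the gradient along them at once,
  even though the gradient is discontinuous for \<open>\<epsilon> = 0\<close>.\<close>

definition history :: "nat \<Rightarrow> 'w \<Rightarrow> nat \<times> nat \<Rightarrow> nat" where
  "history t \<omega> = (\<lambda>(s, k)\<in>draws_before t. r s k \<omega>)"

abbreviation histories :: "nat \<Rightarrow> (nat \<times> nat \<Rightarrow> nat) set" where
  "histories t \<equiv> draws_before t \<rightarrow>\<^sub>E {1..R}"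

definition past :: "nat \<Rightarrow> 'w measure" where
  "past t = vimage_algebra (space M) (history t) (count_space (histories t))"

lemma finite_histories: "finite (histories t)"
  by (intro finite_PiE) (auto simp: draws_before_def)

lemma draw_measurable: "k \<in> {1..K} \<Longrightarrow> r t k \<in> measurable M (count_space {1..R})"
  using indep by (auto simp: indep_vars_def)

lemma of_bool_draw_measurable:
  assumes "k \<in> {1..K}"
  shows "(\<lambda>\<omega>. of_bool (r t k \<omega> = s) :: real) \<in> borel_measurable M"
  by (rule measurable_compose[OF draw_measurable[OF assms]]) simp

lemma draw_in_range: "\<lbrakk>\<omega> \<in> space M; k \<in> {1..K}\<rbrakk> \<Longrightarrow> r t k \<omega> \<in> {1..R}"
  using measurable_space[OF draw_measurable] by simp

lemma history_measurable: "history t \<in> measurable M (count_space (histories t))"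
proof -
  have "history t \<in> measurable M (PiM (draws_before t) (\<lambda>_. count_space {1..R}))"
    unfolding history_def
    by (intro measurable_restrict) (use draw_measurable in \<open>auto simp: draws_before_def\<close>)
  then show ?thesis
    by (subst (asm) count_space_PiM_finite) (auto simp: draws_before_def)
qed

lemma history_in_histories: "history t \<in> space M \<rightarrow> histories t"
  using measurable_space[OF history_measurable] by simp

lemma history_past_measurable: "history t \<in> measurable (past t) (count_space (histories t))"
  unfolding past_def by (rule measurable_vimage_algebra1) (simp only: space_count_space history_in_histories)

lemma function_of_history_measurable:
  fixes f :: "_ \<Rightarrow> 'b::topological_space"
  shows "(\<lambda>\<omega>. f (history t \<omega>)) \<in> borel_measurable (past t)"
  by (rule measurable_compose[OF history_past_measurable]) simp

lemma function_of_history_bounded: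
  fixes f :: "_ \<Rightarrow> real"
  shows "bounded ((\<lambda>\<omega>. f (history t \<omega>)) ` space M)"
proof (rule finite_imp_bounded, rule finite_subset)
  show "(\<lambda>\<omega>. f (history t \<omega>)) ` space M \<subseteq> f ` histories t"
    using history_in_histories by blast
qed (intro finite_imageI finite_histories)

lemma history_restrict:
  assumes "t \<le> T"
  shows "history t \<omega> = restrict (history T \<omega>) (draws_before t)"
  using assms by (auto simp: history_def draws_before_def restrict_def fun_eq_iff)

sublocale filtered_prob_space M past
proof
  show "subalgebra M (past t)" for t
    using sets_image_in_sets[OF refl history_measurable] by (simp add: subalgebra_def past_def)
  show "subalgebra (past (Suc t)) (past t)" for t
  proof -
    have "(\<lambda>h. restrict h (draws_before t))
        \<in> measurable (count_space (histories (Suc t))) (count_space (histories t))"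
      by (auto simp: draws_before_def PiE_iff)
    then have "(\<lambda>\<omega>. restrict (history (Suc t) \<omega>) (draws_before t))
        \<in> measurable (past (Suc t)) (count_space (histories t))"
      by (rule measurable_compose[OF history_past_measurable])
    then have "history t \<in> measurable (past (Suc t)) (count_space (histories t))"
      by (simp add: history_restrict[of t "Suc t", symmetric])
    moreover have space: "space (past t) = space M" for t
      by (simp add: past_def)
    ultimately have "sets (past t) \<subseteq> sets (past (Suc t))"
      unfolding past_def[of t] by (intro sets_image_in_sets)
    then show ?thesis
      by (simp add: subalgebra_def space)
  qed
qed

text \<open>The sets of \<open>past t\<close> are preimages under the history, so a function measurable with respect to it
  cannot separate two points with the same history.\<close>

lemma past_measurable_factors:
  fixes X :: "'w \<Rightarrow> real"
  assumes X: "X \<in> borel_measurable (past t)"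
  obtains f where "\<And>\<omega>. \<omega> \<in> space M \<Longrightarrow> X \<omega> = f (history t \<omega>)"
proof -
  have same: "X \<omega> = X \<omega>'" if "\<omega> \<in> space M" "\<omega>' \<in> space M" "history t \<omega> = history t \<omega>'" for \<omega> \<omega>'
  proof -
    have "X -` {X \<omega>} \<inter> space (past t) \<in> sets (past t)"
      by (rule measurable_sets[OF X]) simp
    then obtain H where "X -` {X \<omega>} \<inter> space M = history t -` H \<inter> space M"
      unfolding past_def
      by (subst (asm) sets_vimage_algebra2) (simp only: space_count_space history_in_histories, auto)
    then have "X \<upsilon> = X \<omega> \<longleftrightarrow> history t \<upsilon> \<in> H" if "\<upsilon> \<in> space M" for \<upsilon>
      using that by (auto simp: set_eq_iff)
    then show ?thesis
      using that by metis
  qed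
  show ?thesis
  proof (rule that)
    fix \<omega> assume \<omega>: "\<omega> \<in> space M"
    define \<upsilon> where "\<upsilon> = (SOME \<upsilon>. \<upsilon> \<in> space M \<and> history t \<upsilon> = history t \<omega>)"
    have "\<upsilon> \<in> space M \<and> history t \<upsilon> = history t \<omega>"
      unfolding \<upsilon>_def by (rule someI[of _ \<omega>]) (simp add: \<omega>)
    then have "X \<omega> = X \<upsilon>"
      by (intro same[OF \<omega>]) simp_all
    then show "X \<omega> = (\<lambda>h. X (SOME \<upsilon>. \<upsilon> \<in> space M \<and> history t \<upsilon> = h)) (history t \<omega>)"
      by (simp only: \<upsilon>_def)
  qed
qed

text \<open>A draw at time \<open>t\<close> is independent of the draws before \<open>t\<close>, hence of everything that is
  measurable with respect to the past.\<close>

lemma expectation_past_times_draw: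
  fixes X :: "'w \<Rightarrow> real"
  assumes X: "X \<in> borel_measurable (past t)" and "bounded (X ` space M)"
    and k: "k \<in> {1..K}" and s: "s \<in> {1..R}"
  shows "expectation (\<lambda>\<omega>. X \<omega> * of_bool (r t k \<omega> = s)) = p s * expectation X"
proof -
  obtain f where f: "\<And>\<omega>. \<omega> \<in> space M \<Longrightarrow> X \<omega> = f (history t \<omega>)"
    using past_measurable_factors[OF X] by blast
  define Y where "Y \<omega> = (of_bool (r t k \<omega> = s) :: real)" for \<omega>
  define H where "H \<omega> = (\<lambda>i\<in>draws_before t. (case i of (t, k) \<Rightarrow> r t k) \<omega>)" for \<omega>
  define J where "J \<omega> = (\<lambda>i\<in>{(t, k)}. (case i of (t, k) \<Rightarrow> r t k) \<omega>)" for \<omega>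
  have H_eq: "H = history t"
    by (auto simp: H_def history_def restrict_def fun_eq_iff)
  have "indep_var (PiM (draws_before t) (\<lambda>_. count_space {1..R})) H (PiM {(t, k)} (\<lambda>_. count_space {1..R})) J"
    unfolding H_def J_def
    by (rule indep_var_restrict[OF indep]) (use k in \<open>auto simp: draws_before_def\<close>)
  moreover have "f \<in> borel_measurable (PiM (draws_before t) (\<lambda>_. count_space {1..R}))"
    by (subst count_space_PiM_finite) (auto simp: draws_before_def)
  moreover have "(\<lambda>h. of_bool (h (t, k) = s) :: real) \<in> borel_measurable (PiM {(t, k)} (\<lambda>_. count_space {1..R}))"
    by (subst count_space_PiM_finite) auto
  ultimately have "indep_var borel (f \<circ> H) borel ((\<lambda>h. of_bool (h (t, k) = s)) \<circ> J)"
    by (rule indep_var_compose)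
  moreover have "(\<lambda>h. of_bool (h (t, k) = s)) \<circ> J = Y"
    by (auto simp: J_def Y_def fun_eq_iff)
  ultimately have ind: "indep_var borel (\<lambda>\<omega>. f (history t \<omega>)) borel Y"
    by (simp add: H_eq comp_def)
  have draw_event: "{\<omega> \<in> space M. r t k \<omega> = s} \<in> events"
    using draw_measurable[OF k, of t] by measurable
  have Y_ind: "Y \<omega> = indicator {\<omega> \<in> space M. r t k \<omega> = s} \<omega>" if "\<omega> \<in> space M" for \<omega>
    using that by (simp add: Y_def indicator_def)
  have Y_meas: "Y \<in> borel_measurable M"
    unfolding Y_def by (rule of_bool_draw_measurable[OF k])
  have "integrable M (\<lambda>\<omega>. f (history t \<omega>))"
    by (intro integrable_bounded measurable_F_imp_measurable[OF function_of_history_measurable]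
        function_of_history_bounded)
  moreover have "integrable M Y"
    by (rule integrable_const_bound[of _ 1]) (simp_all add: Y_meas, simp add: Y_def)
  ultimately have "expectation (\<lambda>\<omega>. f (history t \<omega>) * Y \<omega>)
      = expectation (\<lambda>\<omega>. f (history t \<omega>)) * expectation Y"
    by (rule indep_var_lebesgue_integral[OF ind])
  also have "expectation Y = expectation (indicator {\<omega> \<in> space M. r t k \<omega> = s})"
    by (intro Bochner_Integration.integral_cong refl Y_ind)
  also have "\<dots> = p s"
    using distr[OF k s] draw_event by (simp add: Int_absorb1 Collect_restrict)
  also have "expectation (\<lambda>\<omega>. f (history t \<omega>) * Y \<omega>) = expectation (\<lambda>\<omega>. X \<omega> * Y \<omega>)"
    by (intro Bochner_Integration.integral_cong) (auto simp: f)
  also have "expectation (\<lambda>\<omega>. f (history t \<omega>)) = expectation X"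
    by (intro Bochner_Integration.integral_cong) (auto simp: f)
  finally show ?thesis
    by (simp add: Y_def mult.commute)
qed

text \<open>Dividing by the probability of the drawn index makes the sample an unbiased estimator of the sum,
  even when the summands are themselves random but determined by the past.\<close>

lemma expectation_importance_sampling:
  fixes X :: "nat \<Rightarrow> 'w \<Rightarrow> real"
  assumes X: "\<And>s. X s \<in> borel_measurable (past t)" and X_bdd: "\<And>s. bounded (X s ` space M)"
    and k: "k \<in> {1..K}"
  shows "integrable M (\<lambda>\<omega>. X (r t k \<omega>) \<omega> / p (r t k \<omega>))"
    and "expectation (\<lambda>\<omega>. X (r t k \<omega>) \<omega> / p (r t k \<omega>)) = (\<Sum>s\<in>{1..R}. expectation (X s))"
proof -
  have split: "X (r t k \<omega>) \<omega> / p (r t k \<omega>)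
      = (\<Sum>s\<in>{1..R}. 1 / p s * (X s \<omega> * of_bool (r t k \<omega> = s)))" if "\<omega> \<in> space M" for \<omega>
  proof -
    have "(\<Sum>s\<in>{1..R}. 1 / p s * (X s \<omega> * of_bool (r t k \<omega> = s)))
        = (\<Sum>s\<in>{1..R}. if s = r t k \<omega> then X s \<omega> / p s else 0)"
      by (intro sum.cong) auto
    then show ?thesis
      using draw_in_range[OF that k, of t] by simp
  qed
  have int: "integrable M (\<lambda>\<omega>. X s \<omega> * of_bool (r t k \<omega> = s))" for s
  proof (intro integrable_bounded bounded_image_times X_bdd)
    show "(\<lambda>\<omega>. X s \<omega> * of_bool (r t k \<omega> = s)) \<in> borel_measurable M"
      by (intro borel_measurable_times measurable_F_imp_measurable[OF X] of_bool_draw_measurable k)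
    show "bounded ((\<lambda>\<omega>. of_bool (r t k \<omega> = s) :: real) ` space M)"
      by (rule finite_imp_bounded, rule finite_subset[of _ "{0, 1}"]) auto
  qed
  then show "integrable M (\<lambda>\<omega>. X (r t k \<omega>) \<omega> / p (r t k \<omega>))"
    by (subst Bochner_Integration.integrable_cong[OF refl split]) auto
  have "expectation (\<lambda>\<omega>. X (r t k \<omega>) \<omega> / p (r t k \<omega>))
      = expectation (\<lambda>\<omega>. \<Sum>s\<in>{1..R}. 1 / p s * (X s \<omega> * of_bool (r t k \<omega> = s)))"
    by (intro Bochner_Integration.integral_cong refl split)
  also have "\<dots> = (\<Sum>s\<in>{1..R}. 1 / p s * expectation (\<lambda>\<omega>. X s \<omega> * of_bool (r t k \<omega> = s)))"
    using int by simp
  also have "\<dots> = (\<Sum>s\<in>{1..R}. expectation (X s))"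
  proof (rule sum.cong)
    show "1 / p s * expectation (\<lambda>\<omega>. X s \<omega> * of_bool (r t k \<omega> = s)) = expectation (X s)"
      if "s \<in> {1..R}" for s
      using p_pos[OF that] by (simp add: expectation_past_times_draw[OF X X_bdd k that])
  qed simp
  finally show "expectation (\<lambda>\<omega>. X (r t k \<omega>) \<omega> / p (r t k \<omega>)) = (\<Sum>s\<in>{1..R}. expectation (X s))" .
qed

end

section \<open>The loss along the flow\<close>

lemma stoch_grad_cong:
  "(\<And>k. k \<in> {1..K} \<Longrightarrow> i k = i' k) \<Longrightarrow> stoch_grad \<epsilon> A y B p K i z = stoch_grad \<epsilon> A y B p K i' z"
  unfolding stoch_grad_def by (intro arg_cong2[where f = scaleR] refl sum.cong) auto

lemma stoch_amp_flow_cong: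
  assumes "\<And>s k. s < t \<Longrightarrow> k \<in> {1..K} \<Longrightarrow> i s k = i' s k"
  shows "stoch_amp_flow \<epsilon> A y B p K \<mu> z0 i t = stoch_amp_flow \<epsilon> A y B p K \<mu> z0 i' t"
  using assms
proof (induction t)
  case (Suc t)
  then have "stoch_amp_flow \<epsilon> A y B p K \<mu> z0 i t = stoch_amp_flow \<epsilon> A y B p K \<mu> z0 i' t"
    by simp
  moreover have "stoch_grad \<epsilon> A y B p K (i t) z = stoch_grad \<epsilon> A y B p K (i' t) z" for z
    using Suc.prems by (intro stoch_grad_cong) simp
  ultimately show ?case
    by simp
qed simp

locale stochastic_amplitude_flow = index_sampling M R K p r
  for M :: "'w measure" and R K p r +
  fixes A :: "complex^'d^'m" and y :: "real^'m" and \<epsilon> :: real and B :: "nat \<Rightarrow> 'm set"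
    and \<mu> :: "nat \<Rightarrow> real" and z0 :: "complex^'d"
  assumes y_nonneg: "\<forall>j. 0 \<le> y $ j" and eps_nonneg: "0 \<le> \<epsilon>"
    and K_pos: "1 \<le> K" and partition: "is_row_partition R B"
    and step_pos: "0 < \<mu> t" and step_square_summable: "summable (\<lambda>t. (\<mu> t)\<^sup>2)"
begin

definition z :: "nat \<Rightarrow> 'w \<Rightarrow> complex^'d" where
  "z t \<omega> = stoch_amp_flow \<epsilon> A y B p K \<mu> z0 (\<lambda>s k. r s k \<omega>) t"

definition g :: "nat \<Rightarrow> 'w \<Rightarrow> complex^'d" where
  "g t \<omega> = stoch_grad \<epsilon> A y B p K (\<lambda>k. r t k \<omega>) (z t \<omega>)"

text \<open>The error made in the first-order term of the descent when the stochastic gradient takes the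
  place of the full one.\<close>

definition noise :: "nat \<Rightarrow> 'w \<Rightarrow> real" where
  "noise t \<omega> = 2 * \<mu> t * (inner (amp_grad \<epsilon> A y (z t \<omega>)) (amp_grad \<epsilon> A y (z t \<omega>))
     - inner (amp_grad \<epsilon> A y (z t \<omega>)) (g t \<omega>))"

lemma z_Suc: "z (Suc t) \<omega> = z t \<omega> - \<mu> t *\<^sub>R g t \<omega>"
  by (simp add: z_def g_def)

lemma z_function_of_history:
  assumes "t \<le> T"
  shows "z t \<omega> = stoch_amp_flow \<epsilon> A y B p K \<mu> z0 (\<lambda>s k. history T \<omega> (s, k)) t"
  unfolding z_def using assms by (intro stoch_amp_flow_cong) (auto simp: history_def draws_before_def)

lemma function_of_z_measurable:
  fixes f :: "complex^'d \<Rightarrow> 'b::topological_space"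
  shows "(\<lambda>\<omega>. f (z t \<omega>)) \<in> borel_measurable (past t)"
  unfolding z_function_of_history[OF order_refl] by (rule function_of_history_measurable)

lemma function_of_z_bounded:
  fixes f :: "complex^'d \<Rightarrow> real"
  shows "bounded ((\<lambda>\<omega>. f (z t \<omega>)) ` space M)"
  unfolding z_function_of_history[OF order_refl] by (rule function_of_history_bounded)

lemma noise_function_of_history: "\<exists>f. \<forall>\<omega>. noise t \<omega> = f (history (Suc t) \<omega>)"
proof -
  have "g t \<omega> = stoch_grad \<epsilon> A y B p K (\<lambda>k. history (Suc t) \<omega> (t, k)) (z t \<omega>)" for \<omega>
    unfolding g_def by (intro stoch_grad_cong) (auto simp: history_def draws_before_def)
  moreover define \<zeta> where "\<zeta> h = stoch_amp_flow \<epsilon> A y B p K \<mu> z0 (\<lambda>s k. h (s, k)) t" for h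
  then have "z t \<omega> = \<zeta> (history (Suc t) \<omega>)" for \<omega>
    by (simp add: z_function_of_history[of t "Suc t"])
  ultimately show ?thesis
    unfolding noise_def
    by (intro exI[of _ "\<lambda>h. 2 * \<mu> t * (inner (amp_grad \<epsilon> A y (\<zeta> h)) (amp_grad \<epsilon> A y (\<zeta> h))
        - inner (amp_grad \<epsilon> A y (\<zeta> h)) (stoch_grad \<epsilon> A y B p K (\<lambda>k. h (t, k)) (\<zeta> h)))"]) simp
qed

text \<open>The stochastic gradient is an unbiased estimator of the full gradient given the past: each of its
  \<open>K\<close> samples is, by importance sampling over the blocks, and averaging preserves this.\<close>

lemma expectation_inner_g:
  assumes X: "X \<in> borel_measurable (past t)" and X_bdd: "bounded (X ` space M)"
  shows "expectation (\<lambda>\<omega>. X \<omega> * inner (v (z t \<omega>)) (g t \<omega>))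
    = expectation (\<lambda>\<omega>. X \<omega> * inner (v (z t \<omega>)) (amp_grad \<epsilon> A y (z t \<omega>)))"
proof -
  define W where "W s \<omega> = X \<omega> * inner (v (z t \<omega>)) (block_grad \<epsilon> A y (B s) (z t \<omega>))" for s \<omega>
  have W: "W s \<in> borel_measurable (past t)" for s
    unfolding W_def by (intro borel_measurable_times X function_of_z_measurable)
  have W_bdd: "bounded (W s ` space M)" for s
    unfolding W_def by (intro bounded_image_times X_bdd function_of_z_bounded)
  have "X \<omega> * inner (v (z t \<omega>)) (g t \<omega>) = 1 / real K * (\<Sum>k\<in>{1..K}. W (r t k \<omega>) \<omega> / p (r t k \<omega>))" for \<omega>
    unfolding g_def stoch_grad_def W_def
    by (simp add: inner_sum_right sum_distrib_left mult_ac)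
  then have "expectation (\<lambda>\<omega>. X \<omega> * inner (v (z t \<omega>)) (g t \<omega>))
      = 1 / real K * expectation (\<lambda>\<omega>. \<Sum>k\<in>{1..K}. W (r t k \<omega>) \<omega> / p (r t k \<omega>))"
    by simp
  also have "expectation (\<lambda>\<omega>. \<Sum>k\<in>{1..K}. W (r t k \<omega>) \<omega> / p (r t k \<omega>))
      = (\<Sum>k\<in>{1..K}. \<Sum>s\<in>{1..R}. expectation (W s))"
  proof (subst Bochner_Integration.integral_sum)
    show "integrable M (\<lambda>\<omega>. W (r t k \<omega>) \<omega> / p (r t k \<omega>))" if "k \<in> {1..K}" for k
      by (rule expectation_importance_sampling(1)[OF W W_bdd that])
    show "(\<Sum>k\<in>{1..K}. expectation (\<lambda>\<omega>. W (r t k \<omega>) \<omega> / p (r t k \<omega>)))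
        = (\<Sum>k\<in>{1..K}. \<Sum>s\<in>{1..R}. expectation (W s))"
      by (intro sum.cong refl expectation_importance_sampling(2)[OF W W_bdd])
  qed
  also have "1 / real K * \<dots> = (\<Sum>s\<in>{1..R}. expectation (W s))"
    using K_pos by simp
  also have "\<dots> = expectation (\<lambda>\<omega>. \<Sum>s\<in>{1..R}. W s \<omega>)"
    by (intro Bochner_Integration.integral_sum[symmetric] integrable_bounded W_bdd
        measurable_F_imp_measurable[OF W])
  also have "(\<lambda>\<omega>. \<Sum>s\<in>{1..R}. W s \<omega>) = (\<lambda>\<omega>. X \<omega> * inner (v (z t \<omega>)) (amp_grad \<epsilon> A y (z t \<omega>)))"
    unfolding W_def sum_block_grad[OF eps_nonneg partition, symmetric]
    by (simp only: inner_sum_right sum_distrib_left)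
  finally show ?thesis .
qed

lemma martingale_difference_noise: "martingale_difference noise"
  unfolding martingale_difference_def
proof (intro conjI allI impI)
  show "noise t \<in> borel_measurable (past (Suc t))" for t
  proof -
    obtain f where "noise t = (\<lambda>\<omega>. f (history (Suc t) \<omega>))"
      using noise_function_of_history by (auto simp: fun_eq_iff)
    then show ?thesis
      by (simp only: function_of_history_measurable)
  qed
  fix t and X :: "'w \<Rightarrow> real"
  assume X: "X \<in> borel_measurable (past t)" and X_bdd: "bounded (X ` space M)"
  let ?G = "\<lambda>\<omega>. amp_grad \<epsilon> A y (z t \<omega>)"
  obtain f where f: "\<And>\<omega>. noise t \<omega> = f (history (Suc t) \<omega>)"
    using noise_function_of_history by blast
  have 1: "integrable M (\<lambda>\<omega>. X \<omega> * inner (?G \<omega>) (?G \<omega>))"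
    by (intro integrable_bounded bounded_image_times X_bdd function_of_z_bounded
        borel_measurable_times measurable_F_imp_measurable[OF X]
        measurable_F_imp_measurable[OF function_of_z_measurable])
  have 2: "integrable M (\<lambda>\<omega>. X \<omega> * noise t \<omega>)"
    unfolding f
    by (intro integrable_bounded bounded_image_times X_bdd function_of_history_bounded
        borel_measurable_times measurable_F_imp_measurable[OF X]
        measurable_F_imp_measurable[OF function_of_history_measurable])
  have g: "X \<omega> * inner (?G \<omega>) (g t \<omega>)
      = X \<omega> * inner (?G \<omega>) (?G \<omega>) - 1 / (2 * \<mu> t) * (X \<omega> * noise t \<omega>)" for \<omega>
    using step_pos[of t] by (simp add: noise_def field_simps)
  have "expectation (\<lambda>\<omega>. X \<omega> * inner (?G \<omega>) (g t \<omega>))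
      = expectation (\<lambda>\<omega>. X \<omega> * inner (?G \<omega>) (?G \<omega>)) - 1 / (2 * \<mu> t) * expectation (\<lambda>\<omega>. X \<omega> * noise t \<omega>)"
    unfolding g using 1 2 by simp
  then show "expectation (\<lambda>\<omega>. X \<omega> * noise t \<omega>) = 0"
    using step_pos[of t] by (simp add: expectation_inner_g[OF X X_bdd])
qed

text \<open>Descent along the stochastic gradient is descent along the full gradient plus a quadratic error
  of order \<open>(\<mu> t)\<^sup>2\<close> times the loss, plus the noise, which is of order \<open>\<mu> t\<close> times the loss.  This is an
  almost supermartingale because the squares of the step sizes are summable.\<close>

theorem AE_loss_converges_and_gradient_summable:
  "AE \<omega> in M. convergent (\<lambda>t. amp_loss \<epsilon> A y (z t \<omega>))
    \<and> summable (\<lambda>t. \<mu> t * (norm (amp_grad \<epsilon> A y (z t \<omega>)))\<^sup>2)"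
proof -
  define a q where "a = spectral_norm A" and "q = (\<Sum>s\<in>{1..R}. 1 / p s)"
  have "0 \<le> a" and "0 \<le> q"
    using p_pos by (auto simp: a_def q_def spectral_norm_nonneg less_imp_le intro!: sum_nonneg)
  have p: "\<forall>s\<in>{1..R}. 0 < p s"
    using p_pos by blast
  let ?L = "\<lambda>t \<omega>. amp_loss \<epsilon> A y (z t \<omega>)" and ?G = "\<lambda>t \<omega>. amp_grad \<epsilon> A y (z t \<omega>)"
  have "AE \<omega> in M. convergent (\<lambda>t. ?L t \<omega>) \<and> summable (\<lambda>t. 2 * \<mu> t * (norm (?G t \<omega>))\<^sup>2)"
  proof (rule AE_almost_supermartingale_converges[where D = noise
        and a = "\<lambda>t. (a\<^sup>2 * q)\<^sup>2 * (\<mu> t)\<^sup>2" and b = "\<lambda>t. 2 * (a\<^sup>2 * (1 + q)) * \<mu> t"])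
    show "martingale_difference noise"
      by (rule martingale_difference_noise)
    show "?L t \<in> borel_measurable (past t)" for t
      by (rule function_of_z_measurable)
    show "bounded (?L 0 ` space M)"
      by (rule function_of_z_bounded)
    show "0 \<le> ?L t \<omega>" "0 \<le> 2 * \<mu> t * (norm (?G t \<omega>))\<^sup>2" for t \<omega>
      using step_pos[of t] by (simp_all add: amp_loss_nonneg)
    show "0 \<le> (a\<^sup>2 * q)\<^sup>2 * (\<mu> t)\<^sup>2" "0 \<le> 2 * (a\<^sup>2 * (1 + q)) * \<mu> t" for t
      using step_pos[of t] \<open>0 \<le> q\<close> by simp_all
    show "summable (\<lambda>t. (a\<^sup>2 * q)\<^sup>2 * (\<mu> t)\<^sup>2)" "summable (\<lambda>t. (2 * (a\<^sup>2 * (1 + q)) * \<mu> t)\<^sup>2)"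
      unfolding power_mult_distrib[of _ "\<mu> _"]
      by (intro summable_mult step_square_summable)+
  next
    fix t \<omega> assume \<omega>: "\<omega> \<in> space M"
    have i: "\<forall>k\<in>{1..K}. r t k \<omega> \<in> {1..R}"
      using draw_in_range[OF \<omega>] by blast
    show "?L (Suc t) \<omega> \<le> (1 + (a\<^sup>2 * q)\<^sup>2 * (\<mu> t)\<^sup>2) * ?L t \<omega> - 2 * \<mu> t * (norm (?G t \<omega>))\<^sup>2 + noise t \<omega>"
      using amp_loss_stochastic_step[OF eps_nonneg y_nonneg p K_pos i, where m = "\<mu> t" and z = "z t \<omega>" and A = A and B = B]
      unfolding z_Suc noise_def a_def q_def g_def power2_norm_eq_inner
      by (simp add: right_diff_distrib)
    \<comment> \<open>Both gradients are at most a multiple of \<open>l\<close>, so the noise is quadratic in \<open>l\<close>, that is,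
      linear in the loss.\<close>
    define l where "l = sqrt (?L t \<omega>)"
    have "0 \<le> l" and l: "l * l = ?L t \<omega>"
      by (simp_all add: l_def amp_loss_nonneg)
    have G: "norm (?G t \<omega>) \<le> a * l"
      unfolding a_def l_def by (rule norm_amp_grad_le[OF eps_nonneg])
    have g: "norm (g t \<omega>) \<le> q * (a * l)"
      unfolding a_def l_def q_def g_def by (rule norm_stoch_grad_le[OF eps_nonneg p K_pos i])
    have "\<bar>inner (?G t \<omega>) (?G t \<omega>) - inner (?G t \<omega>) (g t \<omega>)\<bar> = \<bar>inner (?G t \<omega>) (?G t \<omega> - g t \<omega>)\<bar>"
      by (simp add: inner_diff_right)
    also have "\<dots> \<le> norm (?G t \<omega>) * norm (?G t \<omega> - g t \<omega>)"
      by (rule Cauchy_Schwarz_ineq2)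
    also have "\<dots> \<le> (a * l) * (a * l + q * (a * l))"
      using G g \<open>0 \<le> a\<close> \<open>0 \<le> l\<close> by (intro mult_mono order_trans[OF norm_triangle_ineq4] add_mono) auto
    also have "\<dots> = a\<^sup>2 * (1 + q) * (l * l)"
      by (simp add: power2_eq_square algebra_simps)
    finally have "2 * \<mu> t * \<bar>inner (?G t \<omega>) (?G t \<omega>) - inner (?G t \<omega>) (g t \<omega>)\<bar>
        \<le> 2 * \<mu> t * (a\<^sup>2 * (1 + q) * (l * l))"
      using step_pos[of t] by (intro mult_left_mono) auto
    then show "\<bar>noise t \<omega>\<bar> \<le> 2 * (a\<^sup>2 * (1 + q)) * \<mu> t * ?L t \<omega>"
      using step_pos[of t] by (simp add: noise_def abs_mult l mult_ac)
  qed
  then show ?thesis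
  proof (rule AE_mp, intro AE_I2 impI)
    fix \<omega> assume "convergent (\<lambda>t. ?L t \<omega>) \<and> summable (\<lambda>t. 2 * \<mu> t * (norm (?G t \<omega>))\<^sup>2)"
    then show "convergent (\<lambda>t. ?L t \<omega>) \<and> summable (\<lambda>t. \<mu> t * (norm (?G t \<omega>))\<^sup>2)"
      using summable_mult[of "\<lambda>t. 2 * \<mu> t * (norm (?G t \<omega>))\<^sup>2" "1 / 2"] by simp
  qed
qed

end

section \<open>Rates for the running minimum\<close>

lemma powr_minus_half: "0 < x \<Longrightarrow> x powr (- 1 / 2) = 1 / sqrt x"
  using powr_minus_divide[of x "1 / 2"] by (simp add: powr_half_sqrt)

text \<open>Each of the values \<open>a t\<close> with \<open>t < T\<close> is at least the running minimum.  Starting the sum at \<open>N\<close>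
  leaves a tail of the series on the right, which is what the rate with little-o needs.\<close>

lemma running_min_weighted_sum_le:
  fixes a \<mu> :: "nat \<Rightarrow> real"
  assumes "\<And>t. 0 \<le> a t" "\<And>t. 0 < \<mu> t" "summable (\<lambda>t. \<mu> t * (a t)\<^sup>2)" "1 \<le> T"
  shows "(Min (a ` {0..T - 1}))\<^sup>2 * (\<Sum>t=N..<T. \<mu> t) \<le> (\<Sum>t. \<mu> (t + N) * (a (t + N))\<^sup>2)"
proof -
  have Min_nonneg: "0 \<le> Min (a ` {0..T - 1})"
    using assms(1) by (intro Min.boundedI) auto
  have "(Min (a ` {0..T - 1}))\<^sup>2 * (\<Sum>t=N..<T. \<mu> t) = (\<Sum>t=N..<T. \<mu> t * (Min (a ` {0..T - 1}))\<^sup>2)"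
    by (subst mult.commute) (simp add: sum_distrib_right)
  also have "\<dots> \<le> (\<Sum>t=N..<T. \<mu> t * (a t)\<^sup>2)"
    using assms(2) Min_nonneg by (intro sum_mono mult_left_mono power_mono Min_le) (auto simp: less_imp_le)
  also have "\<dots> = (\<Sum>t<T - N. \<mu> (t + N) * (a (t + N))\<^sup>2)"
    by (rule sum.reindex_bij_witness[of _ "\<lambda>t. t + N" "\<lambda>t. t - N"]) auto
  also have "\<dots> \<le> (\<Sum>t. \<mu> (t + N) * (a (t + N))\<^sup>2)"
    using assms(2) by (intro sum_le_suminf summable_ignore_initial_segment[OF assms(3)])
      (auto simp: less_imp_le)
  finally show ?thesis .
qed

lemma running_min_le:
  fixes a \<mu> :: "nat \<Rightarrow> real"
  assumes "\<And>t. 0 \<le> a t" "\<And>t. 0 < \<mu> t" "summable (\<lambda>t. \<mu> t * (a t)\<^sup>2)" "1 \<le> T"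
  shows "Min (a ` {0..T - 1}) \<le> sqrt (\<Sum>t. \<mu> t * (a t)\<^sup>2) * (\<Sum>t<T. \<mu> t) powr (- 1 / 2)"
proof -
  let ?m = "Min (a ` {0..T - 1})" and ?S = "\<Sum>t<T. \<mu> t"
  have S_pos: "0 < ?S"
    using assms(2,4) by (intro sum_pos) (auto simp: lessThan_empty_iff)
  have "(?m * sqrt ?S)\<^sup>2 \<le> (\<Sum>t. \<mu> t * (a t)\<^sup>2)"
    using running_min_weighted_sum_le[OF assms, of 0] S_pos
    by (simp add: power_mult_distrib atLeast0LessThan)
  then have "?m * sqrt ?S \<le> sqrt (\<Sum>t. \<mu> t * (a t)\<^sup>2)"
    by (rule real_le_rsqrt)
  then show ?thesis
    unfolding powr_minus_half[OF S_pos] using S_pos by (simp add: field_simps)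
qed

text \<open>Take \<open>N\<close> so large that the tail from \<open>N\<close> on is small.  Since the weights have infinite sum, those
  from \<open>N\<close> on eventually make up at least half of the total.\<close>

lemma running_min_smallo:
  fixes a \<mu> :: "nat \<Rightarrow> real"
  assumes "\<And>t. 0 \<le> a t" "\<And>t. 0 < \<mu> t" "summable (\<lambda>t. \<mu> t * (a t)\<^sup>2)"
    and diverges: "filterlim (\<lambda>T. \<Sum>t<T. \<mu> t) at_top sequentially"
  shows "(\<lambda>T. Min (a ` {0..T - 1})) \<in> o(\<lambda>T. (\<Sum>t<T. \<mu> t) powr (- 1 / 2))"
proof (rule landau_o.smallI)
  fix c :: real assume "0 < c"
  have "(\<lambda>N. \<Sum>t. \<mu> (t + N) * (a (t + N))\<^sup>2) \<longlonglongrightarrow> 0"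
    by (rule suminf_exist_split2[OF assms(3)])
  then have "eventually (\<lambda>N. (\<Sum>t. \<mu> (t + N) * (a (t + N))\<^sup>2) < c\<^sup>2 / 2) sequentially"
    using \<open>0 < c\<close> by (intro order_tendstoD) auto
  then obtain N where N: "(\<Sum>t. \<mu> (t + N) * (a (t + N))\<^sup>2) < c\<^sup>2 / 2"
    by (auto simp: eventually_sequentially)
  have "eventually (\<lambda>T. 2 * (\<Sum>t<N. \<mu> t) \<le> (\<Sum>t<T. \<mu> t)) sequentially"
    using diverges by (simp add: filterlim_at_top)
  then show "eventually (\<lambda>T. norm (Min (a ` {0..T - 1})) \<le> c * norm ((\<Sum>t<T. \<mu> t) powr (- 1 / 2))) sequentially"
    using eventually_ge_at_top[of "Suc N"]
  proof eventually_elim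
    case (elim T)
    let ?m = "Min (a ` {0..T - 1})" and ?S = "\<Sum>t<T. \<mu> t"
    have m_nonneg: "0 \<le> ?m"
      using assms(1) by (intro Min.boundedI) auto
    have S_pos: "0 < ?S"
      using assms(2) elim(2) by (intro sum_pos) (auto simp: lessThan_empty_iff)
    have "?S = (\<Sum>t<N. \<mu> t) + (\<Sum>t=N..<T. \<mu> t)"
      using elim(2) by (simp add: atLeast0LessThan[symmetric] sum.atLeastLessThan_concat)
    then have "?S \<le> 2 * (\<Sum>t=N..<T. \<mu> t)"
      using elim(1) by simp
    then have "?m\<^sup>2 * ?S \<le> ?m\<^sup>2 * (2 * (\<Sum>t=N..<T. \<mu> t))"
      by (rule mult_left_mono) simp
    also have "\<dots> \<le> c\<^sup>2"
      using running_min_weighted_sum_le[OF assms(1-3), of T N] elim(2) N by simp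
    finally have "(?m * sqrt ?S)\<^sup>2 \<le> c\<^sup>2"
      using S_pos by (simp add: power_mult_distrib)
    then have "?m * sqrt ?S \<le> c"
      using \<open>0 < c\<close> by (auto intro: power2_le_imp_le)
    then show ?case
      unfolding powr_minus_half[OF S_pos] using S_pos m_nonneg by (simp add: field_simps)
  qed
qed

theorem theorem3p7:
  fixes A :: "complex^'d^'m" and y :: "real^'m" and \<epsilon> :: real
    and R K :: nat and B :: "nat \<Rightarrow> 'm set" and p :: "nat \<Rightarrow> real"
    and M :: "'w measure" and r :: "nat \<Rightarrow> nat \<Rightarrow> 'w \<Rightarrow> nat"
    and \<mu> :: "nat \<Rightarrow> real" and z0 :: "complex^'d" and \<beta> :: real
    and z :: "nat \<Rightarrow> 'w \<Rightarrow> complex^'d" and Csq :: "'w \<Rightarrow> ennreal" and C :: "'w \<Rightarrow> real"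
  defines "\<beta> \<equiv> 1 - 1 / real K"
    and "z \<equiv> (\<lambda>t \<omega>. stoch_amp_flow \<epsilon> A y B p K \<mu> z0 (\<lambda>s k. r s k \<omega>) t)"
    and "Csq \<equiv> (\<lambda>\<omega>. \<Sum>t. ennreal (\<mu> t * (norm (amp_grad \<epsilon> A y (z t \<omega>)))\<^sup>2))"
    and "C \<equiv> (\<lambda>\<omega>. sqrt (enn2real (Csq \<omega>)))"
  assumes "\<forall>j. 0 \<le> y $ j" and "0 \<le> \<epsilon>"
    and "1 \<le> R" and "R \<le> CARD('m)" and "is_row_partition R B"
    and "\<forall>s\<in>{1..R}. 0 < p s \<and> p s < 1" and "(\<Sum>s\<in>{1..R}. p s) = 1"
    and "1 \<le> K"
    and "prob_space M"
    and "prob_space.indep_vars M (\<lambda>_. count_space {1..R}) (\<lambda>(t, k). r t k) (UNIV \<times> {1..K})"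
    and "\<forall>t. \<forall>k\<in>{1..K}. \<forall>s\<in>{1..R}. measure M {\<omega> \<in> space M. r t k \<omega> = s} = p s"
    and "\<forall>t. 0 < \<mu> t"
    and "filterlim (\<lambda>T. \<Sum>t<T. \<mu> t) at_top sequentially"
    and "summable (\<lambda>t. (\<mu> t)\<^sup>2)"
    and "\<forall>t. \<beta> * (spectral_norm A)\<^sup>2 * \<mu> t \<le> 1"
  shows "(AE \<omega> in M. convergent (\<lambda>t. amp_loss \<epsilon> A y (z t \<omega>)))
    \<and> Csq \<in> borel_measurable M
    \<and> (AE \<omega> in M. Csq \<omega> < \<infinity>)
    \<and> (AE \<omega> in M. \<forall>T\<ge>1.
          Min ((\<lambda>t. norm (amp_grad \<epsilon> A y (z t \<omega>))) ` {0..T - 1})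
            \<le> C \<omega> * (\<Sum>t<T. \<mu> t) powr (- 1 / 2))
    \<and> (decseq \<mu> \<and> filterlim (\<lambda>T. \<Sum>t=1..T. \<mu> t / (\<Sum>s<t. \<mu> s)) at_top sequentially
        \<longrightarrow> (AE \<omega> in M.
              (\<lambda>T. Min ((\<lambda>t. norm (amp_grad \<epsilon> A y (z t \<omega>))) ` {0..T - 1}))
                \<in> o(\<lambda>T. (\<Sum>t<T. \<mu> t) powr (- 1 / 2))))"
proof -
  interpret prob_space M
    by fact
  interpret flow: stochastic_amplitude_flow M R K p r A y \<epsilon> B \<mu> z0
    using assms by unfold_locales auto
  have z_eq: "z = flow.z"
    by (simp add: z_def flow.z_def fun_eq_iff)
  have \<mu>_pos: "\<And>t. 0 < \<mu> t"
    using assms by blast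
  let ?G = "\<lambda>t \<omega>. norm (amp_grad \<epsilon> A y (z t \<omega>))"
  have AE: "AE \<omega> in M. convergent (\<lambda>t. amp_loss \<epsilon> A y (z t \<omega>)) \<and> summable (\<lambda>t. \<mu> t * (?G t \<omega>)\<^sup>2)"
    unfolding z_eq by (rule flow.AE_loss_converges_and_gradient_summable)
  have Csq_eq: "Csq \<omega> = ennreal (\<Sum>t. \<mu> t * (?G t \<omega>)\<^sup>2)"
    if "summable (\<lambda>t. \<mu> t * (?G t \<omega>)\<^sup>2)" for \<omega>
    unfolding Csq_def using that \<mu>_pos by (intro suminf_ennreal2) (auto simp: less_imp_le)
  have C_eq: "C \<omega> = sqrt (\<Sum>t. \<mu> t * (?G t \<omega>)\<^sup>2)"
    if "summable (\<lambda>t. \<mu> t * (?G t \<omega>)\<^sup>2)" for \<omega>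
    unfolding C_def Csq_eq[OF that] using that \<mu>_pos
    by (simp add: suminf_nonneg less_imp_le)
  have [measurable]: "?G t \<in> borel_measurable M" for t
    unfolding z_eq by (rule flow.measurable_F_imp_measurable[OF flow.function_of_z_measurable])
  have "Csq \<in> borel_measurable M"
    unfolding Csq_def by measurable
  moreover have "AE \<omega> in M. convergent (\<lambda>t. amp_loss \<epsilon> A y (z t \<omega>))"
    using AE by eventually_elim blast
  moreover have "AE \<omega> in M. Csq \<omega> < \<infinity>"
    using AE by eventually_elim (simp add: Csq_eq)
  moreover have "AE \<omega> in M. \<forall>T\<ge>1. Min ((\<lambda>t. ?G t \<omega>) ` {0..T - 1}) \<le> C \<omega> * (\<Sum>t<T. \<mu> t) powr (- 1 / 2)"
    using AE
  proof eventually_elim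
    case (elim \<omega>)
    show ?case
      unfolding C_eq[OF conjunct2[OF elim]]
      by (intro allI impI running_min_le) (use elim \<mu>_pos in auto)
  qed
  moreover have "AE \<omega> in M. (\<lambda>T. Min ((\<lambda>t. ?G t \<omega>) ` {0..T - 1})) \<in> o(\<lambda>T. (\<Sum>t<T. \<mu> t) powr (- 1 / 2))"
    using AE
  proof eventually_elim
    case (elim \<omega>)
    then show ?case
      using assms \<mu>_pos by (intro running_min_smallo) auto
  qed
  ultimately show ?thesis
    by blast
qed

end
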